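(* Let $(V,Q)$ be a topological vertex operator algebra, let $A,B,C\in V$ (homogeneous with respect to the fermionic grading), let $t>0$, and let $0<\alpha_1,\alpha_2\ll\rho$. Then the following holds in the weak sense: \begin{align*} &\big((A,B)_{\alpha_1},C\big)_{\rho}(t)-\big(A,(B,C)_{\alpha_2}\big)_{\rho}(t)\\ &=Qn_{\rho,\alpha_1,\alpha_2}(A,B,C)(t)+n_{\rho,\alpha_1,\alpha_2}(QA,B,C)(t)\\ &\quad+(-1)^{|A|}n_{\rho,\alpha_1,\alpha_2}(A,QB,C)(t)+(-1)^{|A|+|B|}n_{\rho,\alpha_1,\alpha_2}(A,B,QC)(t), \end{align*} where $$n_{\rho,\alpha_1,\alpha_2}(A,B,C)(t)=n'_{\rho,\alpha_1,\alpha_2}(A,B,C)(t)+\big(m_{\alpha_1}(A,B),C\big)_{\rho}(t),$$ $$n'_{\rho,\alpha_1,\alpha_2}(A,B,C)(t)=\int_{\alpha_2}^{\rho-\alpha_1}(-1)^{|A|}A(t+\rho)\,[b_{-1},B(t'+t)]\,C(t)\,dt'.$$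
   Context: A topological vertex operator algebra (TVOA) is a $\mathbb{Z}$-graded vertex operator superalgebra $V=\bigoplus_{i,\mu}V^i[\mu]$ ($i$ the conformal weight, $\mu$ the fermionic grading) together with elements $J\in V^1[1]$, $b\in V^2[-1]$, $F\in V^1[0]$, $L\in V^2[0]$, with modes $J(z)=\sum_n J_nz^{-n-1}$, $b(z)=\sum_n b_nz^{-n-2}$, $F(z)=\sum_nF_nz^{-n-1}$, $L(z)=\sum_nL_nz^{-n-2}$, such that, with $Q=J_0$, one has $[Q,b(z)]=L(z)$, $Q^2=0$, $b_0^2=0$; here $L$ is the Virasoro element of $V$, and $F_0,L_0$ are diagonalizable, commute, and have as eigenvalues the fermionic grading and the conformal weight respectively. For $A\in V$, $A(z)$ denotes the vertex operator $Y(A,z)$; $|A|$ is the fermionic degree. All brackets $[\cdot,\cdot]$ are supercommutators. The symbol $\ll$ means "much smaller than" and is not quantified further. Weak sense. Arguments $t$ of vertex operators are real and positive. For $v\in V$ and $v^*\in V^*$ (restricted dual), the matrix element $\langle v^*,A_1(t_1)\cdots A_n(t_n)v\rangle$ is well defined for $t_1>\cdots>t_n>0$. An operator expression (a product of vertex operators at decreasing arguments, or an integral of such products over a polytope) is weakly defined if its matrix elements are, and an identity holds in the weak sense if it holds for all matrix elements. For such an operator $X$, $QX$ means the supercommutator $[Q,X]$; for $A\in V$ this agrees with $(QA)(t)=[Q,A(t)]$. Operations. For families of operators $X(s),Y(s)$ (vertex operators, or operators built from them by these operations), $$(X,Y)_\epsilon(t)=X(t+\epsilon)Y(t),\qquad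 m_\epsilon(X,Y)(t)=\int_{-\epsilon}^{0}[b_{-1},X(t'+t+\epsilon)Y(t'+t)]\,dt'.$$ Thus $((A,B)_{\alpha_1},C)_\rho(t)=A(t+\rho+\alpha_1)B(t+\rho)C(t)$, $(A,(B,C)_{\alpha_2})_\rho(t)=A(t+\rho)B(t+\alpha_2)C(t)$, and $(m_{\alpha_1}(A,B),C)_\rho(t)=m_{\alpha_1}(A,B)(t+\rho)\,C(t)$. *)

theory Defs
  imports "HOL-Analysis.Analysis" "HOL-Library.Groups_Big_Fun"
begin

section \<open>Vertex operator superalgebras\<close>

text \<open>
  The data of a vertex operator superalgebra over the complex numbers whose underlying space is a
  whole type. \<open>grade V i \<mu>\<close> is the component of conformal weight \<open>i\<close> and
  fermionic degree \<open>\<mu>\<close>; parity is \<open>\<mu>\<close> mod 2. \<open>mode V A n\<close> is the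
  coefficient of \<open>z\<close> to the power \<open>-n-1\<close> in \<open>Y(A,z)\<close>, irrespective of the
  weight of \<open>A\<close>.
\<close>

record 'v vosa =
  scal :: "complex \<Rightarrow> 'v \<Rightarrow> 'v"
  grade :: "int \<Rightarrow> int \<Rightarrow> 'v set"
  mode :: "'v \<Rightarrow> int \<Rightarrow> 'v \<Rightarrow> 'v"
  vac :: 'v
  L_elem :: 'v
  central_charge :: complex

definition weight_space :: "('v::ab_group_add, 'm) vosa_scheme \<Rightarrow> int \<Rightarrow> 'v set" where
  "weight_space V i = module.span (scal V) (\<Union>\<mu>. grade V i \<mu>)"

definition fermionic_space :: "('v::ab_group_add, 'm) vosa_scheme \<Rightarrow> int \<Rightarrow> 'v set" where
  "fermionic_space V \<mu> = module.span (scal V) (\<Union>i. grade V i \<mu>)"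

text \<open>The conformal vector has weight 2, so \<open>L(z)\<close> has \<open>L_n\<close> at \<open>z\<close> to the power \<open>-n-2\<close>.\<close>

definition L_mode :: "('v, 'm) vosa_scheme \<Rightarrow> int \<Rightarrow> 'v \<Rightarrow> 'v" where
  "L_mode V n = mode V (L_elem V) (n + 1)"

text \<open>
  The axioms are those of Frenkel--Huang--Lepowsky, with the super sign. \<open>jacobi\<close> is the
  Jacobi identity in components (Borcherds identity); by \<open>truncation\<close> its sums have finite
  support.
\<close>

locale vertex_operator_superalgebra = vector_space "scal V"
  for V :: "('v::ab_group_add, 'm) vosa_scheme" +
  assumes grade_subspace: "\<And>i \<mu>. subspace (grade V i \<mu>)"
    and grade_direct_sum:
      "\<And>v. \<exists>!x :: int \<times> int \<Rightarrow> 'v. finite {p. x p \<noteq> 0} \<and>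
          (\<forall>i \<mu>. x (i, \<mu>) \<in> grade V i \<mu>) \<and> v = Sum_any x"
    and weight_bounded_below: "\<exists>N. \<forall>i<N. weight_space V i = {0}"
    and weight_finite_dim: "\<And>i. \<exists>B. finite B \<and> weight_space V i \<subseteq> span B"
    and mode_linear_right: "\<And>A n. Vector_Spaces.linear (scal V) (scal V) (\<lambda>B. mode V A n B)"
    and mode_linear_left: "\<And>n B. Vector_Spaces.linear (scal V) (scal V) (\<lambda>A. mode V A n B)"
    and truncation: "\<And>A B. \<exists>N. \<forall>n\<ge>N. mode V A n B = 0"
    and mode_grade:
      "\<And>A B i j \<mu> \<nu> n. A \<in> grade V i \<mu> \<Longrightarrow> B \<in> grade V j \<nu> \<Longrightarrow>
          mode V A n B \<in> grade V (i + j - n - 1) (\<mu> + \<nu>)"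
    and vac_grade: "vac V \<in> grade V 0 0"
    and vac_mode: "\<And>n B. mode V (vac V) n B = (if n = -1 then B else 0)"
    and creation: "\<And>A. mode V A (-1) (vac V) = A"
    and creation_regular: "\<And>A n. n \<ge> 0 \<Longrightarrow> mode V A n (vac V) = 0"
    and jacobi:
      "\<And>A B C i j \<mu> \<nu> m n r. A \<in> grade V i \<mu> \<Longrightarrow> B \<in> grade V j \<nu> \<Longrightarrow>
          Sum_any (\<lambda>k::nat. scal V (of_int m gchoose k)
              (mode V (mode V A (r + int k) B) (m + n - int k) C)) =
          Sum_any (\<lambda>k::nat. scal V ((-1) ^ k * (of_int r gchoose k))
              (mode V A (m + r - int k) (mode V B (n + int k) C)
               - scal V ((-1) powi (r + \<mu> * \<nu>))
                   (mode V B (n + r - int k) (mode V A (m + int k) C))))"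
    and L_grade: "L_elem V \<in> grade V 2 0"
    and virasoro:
      "\<And>m n v. L_mode V m (L_mode V n v) - L_mode V n (L_mode V m v) =
          scal V (of_int (m - n)) (L_mode V (m + n) v) +
          (if m + n = 0 then scal V (of_int (m ^ 3 - m) / 12 * central_charge V) v else 0)"
    and L0_weight: "\<And>i \<mu> v. v \<in> grade V i \<mu> \<Longrightarrow> L_mode V 0 v = scal V (of_int i) v"
    and L_derivative:
      "\<And>A n v. mode V (L_mode V (-1) A) n v = scal V (- of_int n) (mode V A (n - 1) v)"

section \<open>Topological vertex operator algebras\<close>

record 'v tvoa = "'v vosa" +
  J_elem :: 'v
  b_elem :: 'v
  F_elem :: 'v

definition Q_op :: "('v, 'm) tvoa_scheme \<Rightarrow> 'v \<Rightarrow> 'v" where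
  "Q_op V = mode V (J_elem V) 0"

definition b_mode :: "('v, 'm) tvoa_scheme \<Rightarrow> int \<Rightarrow> 'v \<Rightarrow> 'v" where
  "b_mode V n = mode V (b_elem V) (n + 1)"

definition F_mode :: "('v, 'm) tvoa_scheme \<Rightarrow> int \<Rightarrow> 'v \<Rightarrow> 'v" where
  "F_mode V n = mode V (F_elem V) n"

text \<open>
  \<open>Q_b\<close> is the supercommutator relation \<open>[Q, b(z)] = L(z)\<close>, mode by mode; both
  entries are odd, so it is an anticommutator. Since \<open>V\<close> is the direct sum of the
  \<open>grade V i \<mu>\<close>, the facts \<open>L0_weight\<close> and \<open>F0_degree\<close> say that \<open>L_0\<close> and
  \<open>F_0\<close> are simultaneously diagonalizable (so they commute) with the two gradings as
  eigenvalues.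
\<close>

locale topological_vertex_operator_algebra = vertex_operator_superalgebra V
  for V :: "('v::ab_group_add, 'm) tvoa_scheme" +
  assumes J_grade: "J_elem V \<in> grade V 1 1"
    and b_grade: "b_elem V \<in> grade V 2 (-1)"
    and F_grade: "F_elem V \<in> grade V 1 0"
    and Q_b: "\<And>n v. Q_op V (b_mode V n v) + b_mode V n (Q_op V v) = L_mode V n v"
    and Q_square: "\<And>v. Q_op V (Q_op V v) = 0"
    and b0_square: "\<And>v. b_mode V 0 (b_mode V 0 v) = 0"
    and F0_degree: "\<And>i \<mu> v. v \<in> grade V i \<mu> \<Longrightarrow> F_mode V 0 v = scal V (of_int \<mu>) v"

section \<open>Operator expressions and their matrix elements\<close>

text \<open>
  A factor \<open>Factor f\<close> is a series of operators \<open>f k\<close> on \<open>V\<close>, indexed by the integers and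
  summed only inside matrix elements. Products of factors need not be operators on \<open>V\<close>, so
  expressions are kept formal.
\<close>

datatype 'v opexpr =
    Factor "int \<Rightarrow> 'v \<Rightarrow> 'v"
  | Prod "'v opexpr" "'v opexpr"  (infixr "\<odot>" 75)
  | Plus "'v opexpr" "'v opexpr"  (infixl "\<oplus>" 65)
  | Scale complex "'v opexpr"  (infixr "\<cdot>\<^sub>e" 70)
  | Integral real real "real \<Rightarrow> 'v opexpr"

definition Minus :: "'v opexpr \<Rightarrow> 'v opexpr \<Rightarrow> 'v opexpr"  (infixl "\<ominus>" 65) where
  "X \<ominus> Y = X \<oplus> (-1) \<cdot>\<^sub>e Y"

definition vertex_op :: "('v, 'm) vosa_scheme \<Rightarrow> 'v \<Rightarrow> real \<Rightarrow> 'v opexpr" where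
  "vertex_op V A t = Factor (\<lambda>n v. scal V (complex_of_real t powi (- n - 1)) (mode V A n v))"

definition endo :: "('v \<Rightarrow> 'v::zero) \<Rightarrow> 'v opexpr" where
  "endo T = Factor (\<lambda>n v. if n = 0 then T v else 0)"

text \<open>
  Matrix elements of a product of factors: the absolutely convergent multiple series obtained by
  expanding all factors. (For complex-valued families, \<open>summable_on\<close> is absolute convergence.)
\<close>

definition word_term :: "(int \<Rightarrow> 'v \<Rightarrow> 'v) list \<Rightarrow> int list \<Rightarrow> 'v \<Rightarrow> 'v" where
  "word_term w ks v = foldr (\<lambda>(f, k) u. f k u) (zip w ks) v"

definition word_defined :: "('v \<Rightarrow> complex) \<Rightarrow> 'v \<Rightarrow> (int \<Rightarrow> 'v \<Rightarrow> 'v) list \<Rightarrow> bool" where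
  "word_defined \<phi> v w \<longleftrightarrow> (\<lambda>ks. \<phi> (word_term w ks v)) summable_on {ks. length ks = length w}"

definition word_value :: "('v \<Rightarrow> complex) \<Rightarrow> 'v \<Rightarrow> (int \<Rightarrow> 'v \<Rightarrow> 'v) list \<Rightarrow> complex" where
  "word_value \<phi> v w = infsum (\<lambda>ks. \<phi> (word_term w ks v)) {ks. length ks = length w}"

text \<open>
  An expression is a linear combination of iterated integrals of products of factors, once products
  are distributed over sums and integrals. Given the value \<open>f w\<close> of each product \<open>w\<close> of
  factors, \<open>expr_value X f\<close> is the corresponding combination of integrals;
  \<open>expr_defined X D f\<close> says that all products occurring are defined (\<open>D\<close>) and all
  integrals exist.
\<close>

primrec expr_value ::
  "'v opexpr \<Rightarrow> ((int \<Rightarrow> 'v \<Rightarrow> 'v) list \<Rightarrow> complex) \<Rightarrow> complex" where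
  "expr_value (Factor g) f = f [g]"
| "expr_value (X \<odot> Y) f = expr_value X (\<lambda>u. expr_value Y (\<lambda>w. f (u @ w)))"
| "expr_value (X \<oplus> Y) f = expr_value X f + expr_value Y f"
| "expr_value (c \<cdot>\<^sub>e X) f = c * expr_value X f"
| "expr_value (Integral a b X) f = integral {a..b} (\<lambda>s. expr_value (X s) f)"

primrec expr_defined ::
  "'v opexpr \<Rightarrow> ((int \<Rightarrow> 'v \<Rightarrow> 'v) list \<Rightarrow> bool) \<Rightarrow>
    ((int \<Rightarrow> 'v \<Rightarrow> 'v) list \<Rightarrow> complex) \<Rightarrow> bool" where
  "expr_defined (Factor g) D f = D [g]"
| "expr_defined (X \<odot> Y) D f =
    expr_defined X (\<lambda>u. expr_defined Y (\<lambda>w. D (u @ w)) (\<lambda>w. f (u @ w)))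
      (\<lambda>u. expr_value Y (\<lambda>w. f (u @ w)))"
| "expr_defined (X \<oplus> Y) D f = (expr_defined X D f \<and> expr_defined Y D f)"
| "expr_defined (c \<cdot>\<^sub>e X) D f = expr_defined X D f"
| "expr_defined (Integral a b X) D f =
    (a \<le> b \<and> (\<forall>s\<in>{a..b}. expr_defined (X s) D f) \<and>
     (\<lambda>s. expr_value (X s) f) absolutely_integrable_on {a..b})"

definition restricted_dual :: "('v::ab_group_add, 'm) vosa_scheme \<Rightarrow> ('v \<Rightarrow> complex) set" where
  "restricted_dual V = {\<phi>. Vector_Spaces.linear (scal V) (*) \<phi> \<and>
     finite {i. \<exists>x\<in>weight_space V i. \<phi> x \<noteq> 0}}"

definition matrix_element :: "('v \<Rightarrow> complex) \<Rightarrow> 'v opexpr \<Rightarrow> 'v \<Rightarrow> complex" where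
  "matrix_element \<phi> X v = expr_value X (word_value \<phi> v)"

definition weakly_defined :: "('v::ab_group_add, 'm) vosa_scheme \<Rightarrow> 'v opexpr \<Rightarrow> bool" where
  "weakly_defined V X \<longleftrightarrow>
     (\<forall>\<phi>\<in>restricted_dual V. \<forall>v. expr_defined X (word_defined \<phi> v) (word_value \<phi> v))"

definition weakly_equal ::
  "('v::ab_group_add, 'm) vosa_scheme \<Rightarrow> 'v opexpr \<Rightarrow> 'v opexpr \<Rightarrow> bool" where
  "weakly_equal V X Y \<longleftrightarrow> weakly_defined V X \<and> weakly_defined V Y \<and>
     (\<forall>\<phi>\<in>restricted_dual V. \<forall>v. matrix_element \<phi> X v = matrix_element \<phi> Y v)"

section \<open>The operations\<close>

text \<open>
  Fermionic degrees are passed explicitly (\<open>p\<close>, \<open>q\<close> are those of \<open>X\<close>, \<open>Y\<close>), because the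
  zero vector has no well-defined degree.
\<close>

definition supercomm :: "int \<Rightarrow> 'v opexpr \<Rightarrow> int \<Rightarrow> 'v opexpr \<Rightarrow> 'v opexpr" where
  "supercomm p X q Y = X \<odot> Y \<ominus> (-1) powi (p * q) \<cdot>\<^sub>e (Y \<odot> X)"

definition pairing ::
  "real \<Rightarrow> (real \<Rightarrow> 'v opexpr) \<Rightarrow> (real \<Rightarrow> 'v opexpr) \<Rightarrow> real \<Rightarrow> 'v opexpr" where
  "pairing \<epsilon> X Y t = X (t + \<epsilon>) \<odot> Y t"

definition Q_bracket ::
  "('v::ab_group_add, 'm) tvoa_scheme \<Rightarrow> int \<Rightarrow> 'v opexpr \<Rightarrow> 'v opexpr" where
  "Q_bracket V q X = supercomm 1 (endo (Q_op V)) q X"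

definition b_bracket ::
  "('v::ab_group_add, 'm) tvoa_scheme \<Rightarrow> int \<Rightarrow> 'v opexpr \<Rightarrow> 'v opexpr" where
  "b_bracket V q X = supercomm (-1) (endo (b_mode V (-1))) q X"

definition m_op ::
  "('v::ab_group_add, 'm) tvoa_scheme \<Rightarrow> real \<Rightarrow> int \<Rightarrow> (real \<Rightarrow> 'v opexpr) \<Rightarrow>
    int \<Rightarrow> (real \<Rightarrow> 'v opexpr) \<Rightarrow> real \<Rightarrow> 'v opexpr" where
  "m_op V \<epsilon> p X q Y t =
     Integral (- \<epsilon>) 0 (\<lambda>t'. b_bracket V (p + q) (X (t' + t + \<epsilon>) \<odot> Y (t' + t)))"

definition n'_op ::
  "('v::ab_group_add, 'm) tvoa_scheme \<Rightarrow> real \<Rightarrow> real \<Rightarrow> real \<Rightarrow>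
    int \<Rightarrow> 'v \<Rightarrow> int \<Rightarrow> 'v \<Rightarrow> 'v \<Rightarrow> real \<Rightarrow> 'v opexpr" where
  "n'_op V \<rho> \<alpha>\<^sub>1 \<alpha>\<^sub>2 a A b B C t =
     Integral \<alpha>\<^sub>2 (\<rho> - \<alpha>\<^sub>1) (\<lambda>t'. (-1) powi a \<cdot>\<^sub>e
       (vertex_op V A (t + \<rho>) \<odot> b_bracket V b (vertex_op V B (t' + t)) \<odot> vertex_op V C t))"

definition n_op ::
  "('v::ab_group_add, 'm) tvoa_scheme \<Rightarrow> real \<Rightarrow> real \<Rightarrow> real \<Rightarrow>
    int \<Rightarrow> 'v \<Rightarrow> int \<Rightarrow> 'v \<Rightarrow> 'v \<Rightarrow> real \<Rightarrow> 'v opexpr" where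
  "n_op V \<rho> \<alpha>\<^sub>1 \<alpha>\<^sub>2 a A b B C t =
     n'_op V \<rho> \<alpha>\<^sub>1 \<alpha>\<^sub>2 a A b B C t \<oplus>
     pairing \<rho> (m_op V \<alpha>\<^sub>1 a (vertex_op V A) b (vertex_op V B)) (vertex_op V C) t"

end

theory Submission
  imports Defs
begin

text \<open>
  For \<open>\<phi>\<close> in the restricted dual, every matrix element in the statement reduces to
  three-point functions \<open>three_point V \<phi> v t1 A t2 B t3 C\<close>, the sums of the series of
  \<open>\<phi>(A(t1) B(t2) C(t3) v)\<close>. Given these, the identity is a homotopy formula. The operators
  \<open>Q\<close> and \<open>b_{-1}\<close> are zero modes of \<open>J\<close> and \<open>b\<close>, and a zero mode
  supercommutes with a vertex operator by acting on its argument. Since \<open>[Q, b_{-1}] = L_{-1}\<close>,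
  the four terms on the right add up to the integrals of
  \<open>A(t+\<rho>) [L_{-1}, B(t+s)] C(t)\<close> for \<open>\<alpha>\<^sub>2 \<le> s \<le> \<rho> - \<alpha>\<^sub>1\<close> and of
  \<open>[L_{-1}, A(t+\<rho>+\<alpha>\<^sub>1+s) B(t+\<rho>+s)] C(t)\<close> for \<open>-\<alpha>\<^sub>1 \<le> s \<le> 0\<close>:
  all terms in which \<open>Q\<close> meets a field other than through \<open>[Q, b_{-1}]\<close> cancel
  (\<open>n'_density_homotopy\<close>, \<open>m_density_homotopy\<close>). As \<open>L_{-1}\<close> is differentiation
  of the argument, the integrals are differences of boundary values. The first runs from
  \<open>A(t+\<rho>) B(t+\<alpha>\<^sub>2) C(t)\<close> to \<open>A(t+\<rho>) B(t+\<rho>-\<alpha>\<^sub>1) C(t)\<close>, and the second goes on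
  from there, moving both \<open>A\<close> and \<open>B\<close>, to \<open>A(t+\<rho>+\<alpha>\<^sub>1) B(t+\<rho>) C(t)\<close>.

  The analytic part is that the three-point series converges absolutely for
  \<open>t1 > t2 > t3 > 0\<close> (\<open>coef_summable\<close>) and may be differentiated term by term
  (\<open>three_point_has_vector_derivative\<close>). Convergence comes from locality. In terms of coefficients,
  multiplication by \<open>t1 - t2\<close> is a difference operator on functions of three integers, and after
  applying a high power of the difference operators of all three pairs, the order of the fields
  no longer matters, up to sign. Hence each mode index is bounded below, because any of the three fields may be
  put leftmost, where the weights on which \<open>\<phi>\<close> lives bound its mode index.
  The sum of the mode indices is bounded above, because the weights of \<open>V\<close> are bounded below. So
  the result is a Laurent polynomial (\<open>coef_clearing\<close>). Undoing a difference operator means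
  dividing by \<open>1 - t2/t1\<close> and the like, which preserves absolute convergence
  (\<open>summable_on_of_contraction\<close>).

  The matrix elements of the operator expressions involve series of more than three factors, because
  \<open>Q\<close> and \<open>b_{-1}\<close> stand as separate factors there, and each such series has to converge.
  The operator \<open>Q\<close>, which stands at one end, is absorbed into \<open>\<phi>\<close> or \<open>v\<close>
  (\<open>Q_bracket_n_op\<close>), and \<open>b_{-1}\<close> is moved to the right past the fields, which leaves
  three-point series (\<open>zero_mode_words\<close>).
\<close>

section \<open>Absolutely convergent sums\<close>

text \<open>
  Solving the recursion gives \<open>F n = (\<Sum>j<J. q^j * G (s^j n))\<close>, where the orbit of
  \<open>n\<close> meets a zero of \<open>F\<close> at step \<open>J\<close>. As \<open>s\<close> permutes the indices, each
  \<open>j\<close> contributes at most \<open>q^j\<close> times the total sum of \<open>|G|\<close>. This is how a factor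
  \<open>1 - q\<close> is divided out of a series.
\<close>

lemma summable_on_of_contraction:
  fixes F G :: "'i \<Rightarrow> complex" and q :: real
  assumes G: "G summable_on UNIV" and q: "0 \<le> q" "q < 1" and s: "bij s"
    and rec: "\<And>n. F n = G n + of_real q * F (s n)"
    and van: "\<And>n. \<exists>J. F ((s ^^ J) n) = 0"
  shows "F summable_on UNIV"
proof -
  have unfold: "F n = (\<Sum>j<J. of_real (q ^ j) * G ((s ^^ j) n)) + of_real (q ^ J) * F ((s ^^ J) n)" for n J
  proof (induction J)
    case (Suc J)
    show ?case
      by (subst Suc) (subst rec[of "(s ^^ J) n"], simp add: algebra_simps)
  qed simp
  \<comment> \<open>Reindexing the pairs \<open>(j, n)\<close> bounds the double series by a product of two convergent ones.\<close>
  have bijj: "bij (\<lambda>(j, n). (j, (s ^^ j) n))"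
  proof -
    have "bij (s ^^ j)" for j
      using s by (rule bij_fn)
    then show ?thesis
      by (intro o_bij[where g = "\<lambda>(j, n). (j, inv (s ^^ j) n)"])
        (auto simp: fun_eq_iff bij_is_inj bij_is_surj surj_f_inv_f)
  qed
  have "(\<lambda>j. q ^ j) summable_on UNIV"
    using q by (intro norm_summable_imp_summable_on) (simp add: summable_geometric)
  moreover have "(\<lambda>n. norm (G n)) summable_on UNIV"
    using G by (simp add: summable_on_iff_abs_summable_on_complex)
  ultimately have "(\<lambda>(j, n). q ^ j * norm (G n)) summable_on UNIV \<times> UNIV"
    using q by (intro summable_on_SigmaI[where g = "\<lambda>j. q ^ j * infsum (\<lambda>n. norm (G n)) UNIV"])
      (auto intro!: has_sum_cmult_right summable_on_cmult_left has_sum_infsum)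
  then have "(\<lambda>p. (case p of (j, n) \<Rightarrow> q ^ j * norm (G n))) summable_on UNIV"
    by simp
  then have "(\<lambda>p. (case (case p of (j, n) \<Rightarrow> (j, (s ^^ j) n)) of (j, n) \<Rightarrow> q ^ j * norm (G n))) summable_on UNIV"
    using summable_on_reindex_bij_betw[OF bijj, of "\<lambda>p. (case p of (j, n) \<Rightarrow> q ^ j * norm (G n))"]
    by simp
  then have sum2: "(\<lambda>(j, n). q ^ j * norm (G ((s ^^ j) n))) summable_on UNIV"
    by (simp add: case_prod_unfold)
  then have sum3: "(\<lambda>(n, j). q ^ j * norm (G ((s ^^ j) n))) summable_on UNIV \<times> UNIV"
    using summable_on_swap[of "\<lambda>(j, n). q ^ j * norm (G ((s ^^ j) n))" UNIV UNIV]
    by (simp add: case_prod_unfold)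
  have inner: "(\<lambda>j. q ^ j * norm (G ((s ^^ j) n))) summable_on UNIV" for n
    using summable_on_SigmaD1[OF sum3] q by auto
  have outer: "(\<lambda>n. \<Sum>\<^sub>\<infinity>j. q ^ j * norm (G ((s ^^ j) n))) summable_on UNIV"
    using summable_on_Sigma_banach[OF sum3] by simp
  have "norm (F n) \<le> (\<Sum>\<^sub>\<infinity>j. q ^ j * norm (G ((s ^^ j) n)))" for n
  proof -
    obtain J where J: "F ((s ^^ J) n) = 0"
      using van by blast
    have "norm (F n) \<le> (\<Sum>j<J. q ^ j * norm (G ((s ^^ j) n)))"
      using q by (subst unfold[of n J]) (auto simp: J norm_mult norm_power intro!: sum_norm_le)
    also have "\<dots> \<le> (\<Sum>\<^sub>\<infinity>j. q ^ j * norm (G ((s ^^ j) n)))"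
      using q by (intro finite_sum_le_infsum inner) auto
    finally show ?thesis .
  qed
  then have "(\<lambda>n. norm (F n)) summable_on UNIV"
    by (intro summable_on_comparison_test[OF outer]) auto
  then show ?thesis
    by (simp add: summable_on_iff_abs_summable_on_complex)
qed

text \<open>
  Termwise differentiation for a countable index set: the dominated derivatives converge
  uniformly, so an enumeration of the indices reduces this to the theorem on series.
\<close>

lemma has_vector_derivative_infsum:
  fixes f g :: "'i::countable \<Rightarrow> real \<Rightarrow> complex"
  assumes inf: "infinite (UNIV :: 'i set)" and r: "0 < r"
    and der: "\<And>n s. \<bar>s\<bar> < r \<Longrightarrow> (f n has_vector_derivative g n s) (at s)"
    and bound: "\<And>n s. \<bar>s\<bar> < r \<Longrightarrow> norm (g n s) \<le> M n" and M: "M summable_on UNIV"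
    and conv: "\<And>s. \<bar>s\<bar> < r \<Longrightarrow> (\<lambda>n. f n s) summable_on UNIV"
  shows "((\<lambda>s. infsum (\<lambda>n. f n s) UNIV) has_vector_derivative infsum (\<lambda>n. g n 0) UNIV) (at 0)"
proof -
  define e where "e = from_nat_into (UNIV :: 'i set)"
  have e: "bij e"
    using bij_betw_from_nat_into[OF _ inf] by (simp add: e_def)
  have sums: "(\<lambda>n. h (e n)) sums infsum h UNIV" if "h summable_on UNIV" for h :: "'i \<Rightarrow> complex"
    using that by (intro has_sum_imp_sums) (simp add: has_sum_reindex_bij_betw[OF e] has_sum_infsum)
  have gsum: "(\<lambda>n. g n s) summable_on UNIV" if "\<bar>s\<bar> < r" for s
  proof -
    have "(\<lambda>n. norm (g n s)) summable_on UNIV"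
      using bound[OF that] by (intro summable_on_comparison_test[OF M]) auto
    then show ?thesis
      by (simp add: summable_on_iff_abs_summable_on_complex)
  qed
  let ?S = "{-r<..<r}"
  have M': "summable (\<lambda>n. M (e n))"
    using M by (intro summable_on_imp_summable) (simp add: summable_on_reindex_bij_betw[OF e])
  have unif: "uniform_limit ?S (\<lambda>n s. \<Sum>i<n. g (e i) s) (\<lambda>s. suminf (\<lambda>i. g (e i) s)) sequentially"
    using M' by (intro Weierstrass_m_test[where M = "\<lambda>n. M (e n)"]) (auto intro: bound)
  have "\<exists>F. \<forall>x\<in>?S. (\<lambda>n. f (e n) x) sums F x \<and>
      (F has_derivative (\<lambda>h. h *\<^sub>R infsum (\<lambda>n. g n x) UNIV)) (at x within ?S)"
  proof (rule has_derivative_series[where f' = "\<lambda>n x h. h *\<^sub>R g (e n) x" and x = 0])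
    show "(f (e n) has_derivative (\<lambda>h. h *\<^sub>R g (e n) x)) (at x within ?S)" if "x \<in> ?S" for n x
      using der[of x "e n"] that by (auto simp: has_vector_derivative_def intro: has_derivative_at_withinI)
    show "\<forall>\<^sub>F n in sequentially. \<forall>x\<in>?S. \<forall>h.
        norm ((\<Sum>i<n. h *\<^sub>R g (e i) x) - h *\<^sub>R infsum (\<lambda>n. g n x) UNIV) \<le> \<epsilon> * norm h" if "\<epsilon> > 0" for \<epsilon>
      using uniform_limitD[OF unif that]
    proof eventually_elim
      case (elim n)
      show ?case
      proof (intro ballI allI)
        fix x h assume x: "x \<in> ?S"
        then have "suminf (\<lambda>i. g (e i) x) = infsum (\<lambda>n. g n x) UNIV"
          by (intro sums_unique[symmetric] sums gsum) auto
        then have "norm ((\<Sum>i<n. g (e i) x) - infsum (\<lambda>n. g n x) UNIV) \<le> \<epsilon>"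
          using bspec[OF elim x] by (simp add: dist_norm)
        moreover have "norm ((\<Sum>i<n. h *\<^sub>R g (e i) x) - h *\<^sub>R infsum (\<lambda>n. g n x) UNIV)
            = \<bar>h\<bar> * norm ((\<Sum>i<n. g (e i) x) - infsum (\<lambda>n. g n x) UNIV)"
          by (metis norm_scaleR scaleR_right_diff_distrib scaleR_sum_right)
        ultimately show "norm ((\<Sum>i<n. h *\<^sub>R g (e i) x) - h *\<^sub>R infsum (\<lambda>n. g n x) UNIV) \<le> \<epsilon> * norm h"
          by (metis abs_ge_zero mult.commute mult_left_mono real_norm_def)
      qed
    qed
    show "(\<lambda>n. f (e n) 0) sums infsum (\<lambda>n. f n 0) UNIV"
      using r by (intro sums conv) auto
  qed (use r in auto)
  then obtain F where F: "\<And>x. x \<in> ?S \<Longrightarrow> (\<lambda>n. f (e n) x) sums F x"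
      "\<And>x. x \<in> ?S \<Longrightarrow> (F has_derivative (\<lambda>h. h *\<^sub>R infsum (\<lambda>n. g n x) UNIV)) (at x within ?S)"
    by blast
  have "F x = infsum (\<lambda>n. f n x) UNIV" if "x \<in> ?S" for x
    using sums_unique2[OF F(1)[OF that] sums[OF conv]] that by auto
  moreover have "(F has_vector_derivative infsum (\<lambda>n. g n 0) UNIV) (at 0)"
    using F(2)[of 0] r by (simp add: has_vector_derivative_def at_within_open[of 0 ?S])
  ultimately show ?thesis
    using r by (auto intro: has_vector_derivative_transform_within_open[where S = ?S])
qed

section \<open>Words with inserted operators\<close>

definition endo_series :: "('v \<Rightarrow> 'v::zero) \<Rightarrow> int \<Rightarrow> 'v \<Rightarrow> 'v" where
  "endo_series T = (\<lambda>n v. if n = 0 then T v else 0)"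

lemma endo_eq_Factor: "endo T = Factor (endo_series T)"
  by (simp add: endo_def endo_series_def)

definition word_has_sum ::
  "('v \<Rightarrow> complex) \<Rightarrow> 'v \<Rightarrow> (int \<Rightarrow> 'v \<Rightarrow> 'v) list \<Rightarrow> complex \<Rightarrow> bool" where
  "word_has_sum \<phi> v w S \<longleftrightarrow>
     ((\<lambda>ks. \<phi> (word_term w ks v)) has_sum S) {ks. length ks = length w}"

lemma word_has_sum_iff: "word_has_sum \<phi> v w S \<longleftrightarrow> word_defined \<phi> v w \<and> word_value \<phi> v w = S"
  by (simp add: word_has_sum_def word_defined_def word_value_def has_sum_iff)

lemma word_value_eqI: "(\<And>S. word_has_sum \<phi> v w S \<longleftrightarrow> word_has_sum \<psi> x u S) \<Longrightarrow>
   word_value \<phi> v w = word_value \<psi> x u \<and> word_defined \<phi> v w = word_defined \<psi> x u"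
  unfolding word_has_sum_def word_value_def word_defined_def
  by (auto simp: summable_on_def infsum_def has_sum_def t2_space_class.Lim_def)

lemma word_term_append:
  "length ku = length u \<Longrightarrow> word_term (u @ w) (ku @ kw) v = word_term u ku (word_term w kw v)"
  by (simp add: word_term_def)

lemma word_term_Cons [simp]: "word_term (f # w) (k # ks) v = f k (word_term w ks v)"
  by (simp add: word_term_def)

lemma word_term_Nil [simp]: "word_term [] ks v = v"
  by (simp add: word_term_def)

lemma word_term_zero:
  assumes "\<forall>g\<in>set u. \<forall>k. g k 0 = 0"
  shows "word_term u ku (0 :: 'v::zero) = 0"
  using assms
proof (induction u arbitrary: ku)
  case (Cons g u)
  then show ?case by (cases ku) (auto simp: word_term_def)
qed simp

text \<open>
  An inserted operator has only the coefficient with index 0, so it contributes no summation index.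
  Zero preservation makes the terms with other indices vanish.
\<close>

lemma word_has_sum_endo:
  fixes \<phi> :: "'v::zero \<Rightarrow> complex"
  assumes "\<phi> 0 = 0" and "\<forall>g\<in>set u. \<forall>k. g k 0 = 0"
  shows "word_has_sum \<phi> v (u @ endo_series T # w) S \<longleftrightarrow>
    ((\<lambda>(ku, kw). \<phi> (word_term u ku (T (word_term w kw v)))) has_sum S)
      ({ku. length ku = length u} \<times> {kw. length kw = length w})"
proof -
  let ?P = "{ku. length ku = length u} \<times> {kw. length kw = length w}"
  let ?h = "\<lambda>(ku, kw). ku @ (0::int) # kw"
  have inj: "inj_on ?h ?P"
    by (auto simp: inj_on_def)
  have eq: "word_term (u @ endo_series T # w) (ku @ 0 # kw) v = word_term u ku (T (word_term w kw v))"
    if "length ku = length u" for ku kw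
    using that by (simp add: word_term_append endo_series_def)
  have img: "?h ` ?P \<subseteq> {ks. length ks = length (u @ endo_series T # w)}"
    by auto
  have out: "\<phi> (word_term (u @ endo_series T # w) ks v) = 0"
    if len: "length ks = length (u @ endo_series T # w)" and nin: "ks \<notin> ?h ` ?P" for ks
  proof -
    obtain ku k kw where ks: "ks = ku @ k # kw" "length ku = length u" "length kw = length w"
    proof
      show "ks = take (length u) ks @ ks ! length u # drop (Suc (length u)) ks"
        using len by (intro id_take_nth_drop) simp
    qed (use len in auto)
    have "k \<noteq> 0"
      using nin ks by force
    then show ?thesis
      using assms by (simp add: ks word_term_append word_term_zero endo_series_def)
  qed
  have "word_has_sum \<phi> v (u @ endo_series T # w) S \<longleftrightarrow>
      ((\<lambda>ks. \<phi> (word_term (u @ endo_series T # w) ks v)) has_sum S) (?h ` ?P)"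
    unfolding word_has_sum_def using img out by (intro has_sum_cong_neutral) blast+
  also have "\<dots> \<longleftrightarrow> ((\<lambda>p. \<phi> (word_term (u @ endo_series T # w) (?h p) v)) has_sum S) ?P"
    using has_sum_reindex[OF inj] by (simp add: o_def)
  also have "\<dots> \<longleftrightarrow> ((\<lambda>(ku, kw). \<phi> (word_term u ku (T (word_term w kw v)))) has_sum S) ?P"
    by (intro has_sum_cong) (auto simp: eq)
  finally show ?thesis .
qed

lemma word_has_sum_append:
  "word_has_sum \<phi> v (u @ w) S \<longleftrightarrow>
    ((\<lambda>(ku, kw). \<phi> (word_term u ku (word_term w kw v))) has_sum S)
      ({ku. length ku = length u} \<times> {kw. length kw = length w})"
proof -
  let ?P = "{ku. length ku = length u} \<times> {kw. length kw = length w}"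
  have "word_has_sum \<phi> v (u @ w) S \<longleftrightarrow>
      ((\<lambda>p. \<phi> (word_term (u @ w) ((\<lambda>(ku, kw). ku @ kw) p) v)) has_sum S) ?P"
    unfolding word_has_sum_def
    by (intro has_sum_reindex_bij_betw[symmetric]
          bij_betw_byWitness[where f' = "\<lambda>ks. (take (length u) ks, drop (length u) ks)"]) auto
  also have "\<dots> \<longleftrightarrow> ((\<lambda>(ku, kw). \<phi> (word_term u ku (word_term w kw v))) has_sum S) ?P"
    by (intro has_sum_cong) (auto simp: word_term_append)
  finally show ?thesis .
qed

text \<open>
  At either end of a word, an inserted operator can be absorbed into the functional or the vector.
\<close>

lemma word_endo_Cons:
  fixes \<phi> :: "'v::zero \<Rightarrow> complex"
  assumes "\<phi> 0 = 0"
  shows "word_value \<phi> v (endo_series T # w) = word_value (\<phi> \<circ> T) v w"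
    and "word_defined \<phi> v (endo_series T # w) = word_defined (\<phi> \<circ> T) v w"
proof -
  have eq: "word_has_sum \<phi> v (endo_series T # w) S \<longleftrightarrow> word_has_sum (\<phi> \<circ> T) v w S" for S
    using word_has_sum_endo[where u = "[]" and \<phi> = \<phi> and v = v and T = T and w = w and S = S]
      word_has_sum_append[where u = "[]" and \<phi> = "\<phi> \<circ> T" and v = v and w = w and S = S] assms
    by simp
  then show "word_value \<phi> v (endo_series T # w) = word_value (\<phi> \<circ> T) v w"
    and "word_defined \<phi> v (endo_series T # w) = word_defined (\<phi> \<circ> T) v w"
    using word_value_eqI[OF eq] by simp_all
qed

lemma word_endo_snoc:
  fixes \<phi> :: "'v::zero \<Rightarrow> complex"
  assumes "\<phi> 0 = 0" and "\<forall>g\<in>set w. \<forall>k. g k 0 = 0"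
  shows "word_value \<phi> v (w @ [endo_series T]) = word_value \<phi> (T v) w"
    and "word_defined \<phi> v (w @ [endo_series T]) = word_defined \<phi> (T v) w"
proof -
  have eq: "word_has_sum \<phi> v (w @ [endo_series T]) S \<longleftrightarrow> word_has_sum \<phi> (T v) w S" for S
    using word_has_sum_endo[where \<phi> = \<phi> and u = w and w = "[]" and v = v and T = T and S = S]
      word_has_sum_append[where w = "[]" and u = w and \<phi> = \<phi> and v = "T v" and S = S] assms
    by simp
  then show "word_value \<phi> v (w @ [endo_series T]) = word_value \<phi> (T v) w"
    and "word_defined \<phi> v (w @ [endo_series T]) = word_defined \<phi> (T v) w"
    using word_value_eqI[OF eq] by simp_all
qed

text \<open>
  The step that moves an inserted operator \<open>T\<close> one place to the right, past a factor \<open>f\<close> with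
  \<open>T f = f' + s f T\<close>. The relation is used termwise, so the word with \<open>T\<close> in front of \<open>f\<close>
  converges as soon as the two others do.
\<close>

lemma word_has_sum_commute:
  fixes \<phi> :: "'v::ab_group_add \<Rightarrow> complex"
  assumes zero: "\<phi> 0 = 0" "\<forall>g\<in>set u. \<forall>k. g k 0 = 0" "\<forall>k. f k 0 = 0"
    and comm: "\<And>ku k x. \<phi> (word_term u ku (T (f k x))) =
        \<phi> (word_term u ku (f' k x)) + s * \<phi> (word_term u ku (f k (T x)))"
    and S1: "word_has_sum \<phi> v (u @ f' # w) S1"
    and S2: "word_has_sum \<phi> v (u @ f # endo_series T # w) S2"
  shows "word_has_sum \<phi> v (u @ endo_series T # f # w) (S1 + s * S2)"
proof -
  let ?Q = "{ku. length ku = length u} \<times> {kw. length kw = length (f # w)}"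
  let ?P = "{ku. length ku = length (u @ [f])} \<times> {kw. length kw = length w}"
  have bij: "bij_betw (\<lambda>(ku, kw). (ku @ [hd kw], tl kw)) ?Q ?P"
  proof (rule bij_betw_byWitness[where f' = "\<lambda>(ku, kw). (butlast ku, last ku # kw)"])
    show "\<forall>p\<in>?P. (\<lambda>(ku, kw). (ku @ [hd kw], tl kw)) ((\<lambda>(ku, kw). (butlast ku, last ku # kw)) p) = p"
      by (auto simp: append_butlast_last_id simp flip: length_greater_0_conv)
    show "\<forall>p\<in>?Q. (\<lambda>(ku, kw). (butlast ku, last ku # kw)) ((\<lambda>(ku, kw). (ku @ [hd kw], tl kw)) p) = p"
      by (auto simp flip: length_greater_0_conv)
  qed auto
  have "((\<lambda>(ku, kw). \<phi> (word_term u ku (word_term (f' # w) kw v))) has_sum S1) ?Q"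
    using S1 word_has_sum_append[of \<phi> v u "f' # w"] by simp
  moreover have "((\<lambda>(ku, kw). \<phi> (word_term (u @ [f]) ku (T (word_term w kw v)))) has_sum S2) ?P"
    using S2 word_has_sum_endo[of \<phi> "u @ [f]" v T w S2] zero by simp
  then have "((\<lambda>(ku, kw). \<phi> (word_term (u @ [f]) (ku @ [hd kw]) (T (word_term w (tl kw) v)))) has_sum S2) ?Q"
    by (subst (asm) has_sum_reindex_bij_betw[OF bij, symmetric]) (simp add: case_prod_unfold)
  ultimately have "((\<lambda>p. (case p of (ku, kw) \<Rightarrow> \<phi> (word_term u ku (word_term (f' # w) kw v))) +
      s * (case p of (ku, kw) \<Rightarrow> \<phi> (word_term (u @ [f]) (ku @ [hd kw]) (T (word_term w (tl kw) v)))))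
      has_sum (S1 + s * S2)) ?Q"
    by (intro has_sum_add has_sum_cmult_right)
  also have "?this \<longleftrightarrow> ((\<lambda>(ku, kw). \<phi> (word_term u ku (T (word_term (f # w) kw v)))) has_sum (S1 + s * S2)) ?Q"
  proof (intro has_sum_cong)
    fix p :: "int list \<times> int list" assume "p \<in> ?Q"
    then obtain ku k kw where "p = (ku, k # kw)" "length ku = length u"
      by (cases p; cases "snd p") auto
    then show "(case p of (ku, kw) \<Rightarrow> \<phi> (word_term u ku (word_term (f' # w) kw v))) +
        s * (case p of (ku, kw) \<Rightarrow> \<phi> (word_term (u @ [f]) (ku @ [hd kw]) (T (word_term w (tl kw) v)))) =
        (case p of (ku, kw) \<Rightarrow> \<phi> (word_term u ku (T (word_term (f # w) kw v))))"
      by (simp add: word_term_append comm)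
  qed
  finally show ?thesis
    using word_has_sum_endo[of \<phi> u v T "f # w"] zero by simp
qed

lemma word_has_sum_three:
  "word_has_sum \<phi> v [f, g, h] S \<longleftrightarrow>
    ((\<lambda>(k, l, m). \<phi> (f k (g l (h m v)))) has_sum S) UNIV"
proof -
  have "bij_betw (\<lambda>(k, l, m). [k, l, m :: int]) UNIV {ks. length ks = length [f, g, h]}"
  proof (rule bij_betw_byWitness[where f' = "\<lambda>ks. (ks ! 0, ks ! 1, ks ! 2)"])
    show "\<forall>ks\<in>{ks. length ks = length [f, g, h]}.
        (\<lambda>(k, l, m). [k, l, m]) (ks ! 0, ks ! 1, ks ! 2) = ks"
      by (auto intro!: nth_equalityI simp: less_Suc_eq numeral_2_eq_2 numeral_3_eq_3)
  qed auto
  from has_sum_reindex_bij_betw[OF this, of "\<lambda>ks. \<phi> (word_term [f, g, h] ks v)" S] show ?thesis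
    by (simp add: word_has_sum_def case_prod_unfold)
qed

section \<open>Difference operators on coefficient functions\<close>

text \<open>
  If \<open>F\<close> is the coefficient function of a series in several variables, then \<open>diff_op x y F\<close> for
  unit vectors \<open>x\<close>, \<open>y\<close> is that of its product with the difference of the two variables.
\<close>

definition diff_op :: "'i::ab_group_add \<Rightarrow> 'i \<Rightarrow> ('i \<Rightarrow> complex) \<Rightarrow> 'i \<Rightarrow> complex" where
  "diff_op x y F n = F (n + x) - F (n + y)"

lemma diff_op_commute: "diff_op x y (diff_op z w F) = diff_op z w (diff_op x y F)"
  by (auto simp: diff_op_def fun_eq_iff algebra_simps)

lemma diff_op_funpow_commute: "(diff_op x y ^^ M) ((diff_op z w ^^ N) F) = (diff_op z w ^^ N) ((diff_op x y ^^ M) F)"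
proof -
  have "diff_op x y ((diff_op z w ^^ N) F) = (diff_op z w ^^ N) (diff_op x y F)" for F
    by (induction N) (simp_all, metis diff_op_commute)
  then show ?thesis
    by (induction M) simp_all
qed

text \<open>
  Pascal's rule, in the form needed to expand a power of a difference of two commuting shifts.
\<close>

lemma alternating_binomial_Suc:
  fixes T :: "nat \<Rightarrow> nat \<Rightarrow> complex"
  shows "(\<Sum>k\<le>Suc N. (-1) ^ k * of_nat (Suc N choose k) * T (Suc N - k) k) =
    (\<Sum>k\<le>N. (-1) ^ k * of_nat (N choose k) * (T (Suc (N - k)) k - T (N - k) (Suc k)))"
proof -
  have "(\<Sum>k\<le>Suc N. (-1) ^ k * of_nat (Suc N choose k) * T (Suc N - k) k) =
      T (Suc N) 0 + (\<Sum>k\<le>N. (-1) ^ Suc k * of_nat (N choose Suc k) * T (N - k) (Suc k))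
        + (\<Sum>k\<le>N. (-1) ^ Suc k * of_nat (N choose k) * T (N - k) (Suc k))"
    by (subst sum.atMost_Suc_shift) (simp add: sum.distrib[symmetric] algebra_simps)
  also have "T (Suc N) 0 + (\<Sum>k\<le>N. (-1) ^ Suc k * of_nat (N choose Suc k) * T (N - k) (Suc k))
      = (\<Sum>k\<le>Suc N. (-1) ^ k * of_nat (N choose k) * T (Suc N - k) k)"
    by (subst sum.atMost_Suc_shift) simp
  also have "\<dots> = (\<Sum>k\<le>N. (-1) ^ k * of_nat (N choose k) * T (Suc (N - k)) k)"
    by (simp add: Suc_diff_le)
  finally show ?thesis
    by (simp add: sum.distrib[symmetric] algebra_simps)
qed

lemma diff_op_funpow:
  "(diff_op x y ^^ N) F n =
    (\<Sum>k\<le>N. (-1) ^ k * of_nat (N choose k) * F (n + (\<Sum>i<N - k. x) + (\<Sum>i<k. y)))"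
proof (induction N arbitrary: F)
  case (Suc N)
  have "(diff_op x y ^^ Suc N) F n = (diff_op x y ^^ N) (diff_op x y F) n"
    by (simp add: funpow_swap1)
  also have "\<dots> = (\<Sum>k\<le>N. (-1) ^ k * of_nat (N choose k) *
      (F (n + (\<Sum>i<Suc (N - k). x) + (\<Sum>i<k. y)) - F (n + (\<Sum>i<N - k. x) + (\<Sum>i<Suc k. y))))"
    by (subst Suc) (simp add: diff_op_def algebra_simps)
  finally show ?case
    using alternating_binomial_Suc[of N "\<lambda>j k. F (n + (\<Sum>i<j. x) + (\<Sum>i<k. y))"] by simp
qed simp

lemma diff_op_funpow_scale: "(diff_op x y ^^ N) (\<lambda>n. s * F n) = (\<lambda>n. s * (diff_op x y ^^ N) F n)"
proof (induction N)
  case (Suc N)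
  show ?case
    unfolding funpow.simps o_apply Suc by (rule ext) (simp add: diff_op_def algebra_simps)
qed simp

text \<open>
  The condition that singles out the expansion in the domain of interest: along the direction
  \<open>d\<close> of the geometric series by which a factor is divided out, \<open>F\<close> vanishes eventually.
\<close>

definition dies_along :: "'i::ab_group_add \<Rightarrow> ('i \<Rightarrow> complex) \<Rightarrow> bool" where
  "dies_along d F \<longleftrightarrow> (\<forall>n. \<exists>J::nat. \<forall>j\<ge>J. F (n + (\<Sum>i<j. d)) = 0)"

lemma dies_along_diff_op: "dies_along d F \<Longrightarrow> dies_along d (diff_op x y F)"
  unfolding dies_along_def
proof
  fix n assume F: "\<forall>n. \<exists>J::nat. \<forall>j\<ge>J. F (n + (\<Sum>i<j. d)) = 0"
  obtain J1 :: nat where J1: "\<forall>j\<ge>J1. F (n + x + (\<Sum>i<j. d)) = 0" using F by blast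
  obtain J2 :: nat where J2: "\<forall>j\<ge>J2. F (n + y + (\<Sum>i<j. d)) = 0" using F by blast
  show "\<exists>J::nat. \<forall>j\<ge>J. diff_op x y F (n + (\<Sum>i<j. d)) = 0"
    using J1 J2 by (intro exI[of _ "max J1 J2"]) (auto simp: diff_op_def ac_simps)
qed

lemma dies_along_diff_op_funpow: "dies_along d F \<Longrightarrow> dies_along d ((diff_op x y ^^ N) F)"
  by (induction N) (auto intro: dies_along_diff_op)

text \<open>
  With the weights \<open>W\<close> absorbed, \<open>F (n + x) = diff_op x y F n + F (n + y)\<close> is a contraction with
  factor \<open>p / p'\<close>.
\<close>

lemma summable_of_diff_op:
  fixes F :: "'i::ab_group_add \<Rightarrow> complex" and W :: "'i \<Rightarrow> complex"
  assumes Wx: "\<And>n. W (n + x) = of_real p * W n" and Wy: "\<And>n. W (n + y) = of_real p' * W n"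
    and p: "0 < p" "p < p'"
    and van: "dies_along (y - x) F"
    and sum: "(\<lambda>n. W n * diff_op x y F n) summable_on UNIV"
  shows "(\<lambda>n. W n * F n) summable_on UNIV"
proof (rule summable_on_of_contraction[where q = "p / p'" and s = "\<lambda>n. n + (y - x)"])
  have "bij (\<lambda>n. n - x)"
    by (rule o_bij[where g = "\<lambda>n. n + x"]) auto
  then have "(\<lambda>n. W (n - x) * diff_op x y F (n - x)) summable_on UNIV"
    using summable_on_reindex_bij_betw[of "\<lambda>n. n - x" UNIV UNIV "\<lambda>n. W n * diff_op x y F n"] sum by simp
  then show "(\<lambda>n. of_real p * (W (n - x) * diff_op x y F (n - x))) summable_on UNIV"
    by (rule summable_on_cmult_right)
  show "bij (\<lambda>n. n + (y - x))"
    by (rule o_bij[where g = "\<lambda>n. n - (y - x)"]) auto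
  show "0 \<le> p / p'" "p / p' < 1"
    using p by auto
  fix n
  have "W n = of_real p * W (n - x)" "W (n + (y - x)) = of_real p' * W (n - x)"
    using Wx[of "n - x"] Wy[of "n - x"] by (simp_all add: algebra_simps)
  then show "W n * F n = of_real p * (W (n - x) * diff_op x y F (n - x)) +
      of_real (p / p') * (W (n + (y - x)) * F (n + (y - x)))"
    using p by (simp add: diff_op_def algebra_simps)
  obtain J :: nat where "\<forall>j\<ge>J. F (n + (\<Sum>i<j. y - x)) = 0"
    using van by (auto simp: dies_along_def)
  moreover have "((\<lambda>n. n + (y - x)) ^^ j) n = n + (\<Sum>i<j. y - x)" for j
    by (induction j) (simp_all add: algebra_simps)
  ultimately show "\<exists>J. W (((\<lambda>n. n + (y - x)) ^^ J) n) * F (((\<lambda>n. n + (y - x)) ^^ J) n) = 0"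
    by (metis mult_zero_right order_refl)
qed

lemma summable_of_diff_op_funpow:
  fixes F :: "'i::ab_group_add \<Rightarrow> complex" and W :: "'i \<Rightarrow> complex"
  assumes Wx: "\<And>n. W (n + x) = of_real p * W n" and Wy: "\<And>n. W (n + y) = of_real p' * W n"
    and p: "0 < p" "p < p'"
    and van: "dies_along (y - x) F"
    and sum: "(\<lambda>n. W n * (diff_op x y ^^ N) F n) summable_on UNIV"
  shows "(\<lambda>n. W n * F n) summable_on UNIV"
  using sum
proof (induction N)
  case (Suc N)
  then have "(\<lambda>n. W n * diff_op x y ((diff_op x y ^^ N) F) n) summable_on UNIV"
    by simp
  from summable_of_diff_op[OF Wx Wy p dies_along_diff_op_funpow[OF van] this] show ?case
    by (rule Suc.IH)
qed simp

text \<open>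
  Lower bounds on the support are expressed by taking the negative of a coordinate for \<open>c\<close>.
\<close>

definition vanishes_above :: "('i \<Rightarrow> int) \<Rightarrow> ('i \<Rightarrow> complex) \<Rightarrow> bool" where
  "vanishes_above c F \<longleftrightarrow> (\<exists>K. \<forall>n. c n > K \<longrightarrow> F n = 0)"

lemma vanishes_above_diff_op_funpow:
  assumes "\<And>n. c (n + x) \<ge> c n - 1" "\<And>n. c (n + y) \<ge> c n - 1" and "vanishes_above c F"
  shows "vanishes_above c ((diff_op x y ^^ N) F)"
proof (induction N)
  case (Suc N)
  then obtain K where K: "\<And>n. c n > K \<Longrightarrow> (diff_op x y ^^ N) F n = 0"
    by (auto simp: vanishes_above_def)
  have "c n > K + 1 \<Longrightarrow> (diff_op x y ^^ Suc N) F n = 0" for n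
    using K[of "n + x"] K[of "n + y"] assms(1)[of n] assms(2)[of n] by (simp add: diff_op_def)
  then show ?case
    unfolding vanishes_above_def by blast
qed (use assms in simp)

lemma vanishes_above_scale: "vanishes_above c F \<Longrightarrow> vanishes_above c (\<lambda>n. s * F n)"
  by (auto simp: vanishes_above_def)

abbreviation e1 :: "int \<times> int \<times> int" where "e1 \<equiv> (1, 0, 0)"
abbreviation e2 :: "int \<times> int \<times> int" where "e2 \<equiv> (0, 1, 0)"
abbreviation e3 :: "int \<times> int \<times> int" where "e3 \<equiv> (0, 0, 1)"

lemma sum_triple: "(\<Sum>i<j::nat. (k, l, m)) = (int j * k, int j * l, int j * m)"
  by (induction j) (simp_all add: algebra_simps zero_prod_def)

abbreviation sum_coords :: "int \<times> int \<times> int \<Rightarrow> int" where "sum_coords \<equiv> \<lambda>(k, l, m). k + l + m"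

text \<open>
  Lower bounds on the three coordinates and an upper bound on their sum leave finitely many triples.
\<close>

lemma finite_support_of_vanishing:
  assumes "vanishes_above (\<lambda>(k, l, m). - k) F" "vanishes_above (\<lambda>(k, l, m). - l) F"
    "vanishes_above (\<lambda>(k, l, m). - m) F" "vanishes_above sum_coords F"
  shows "finite {n. F n \<noteq> 0}"
proof -
  obtain K1 where K1: "\<And>k l m. - k > K1 \<Longrightarrow> F (k, l, m) = 0"
    using assms(1) by (auto simp: vanishes_above_def)
  obtain K2 where K2: "\<And>k l m. - l > K2 \<Longrightarrow> F (k, l, m) = 0"
    using assms(2) by (auto simp: vanishes_above_def)
  obtain K3 where K3: "\<And>k l m. - m > K3 \<Longrightarrow> F (k, l, m) = 0"
    using assms(3) by (auto simp: vanishes_above_def)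
  obtain K where K: "\<And>k l m. k + l + m > K \<Longrightarrow> F (k, l, m) = 0"
    using assms(4) by (auto simp: vanishes_above_def)
  have "{n. F n \<noteq> 0} \<subseteq> {- K1..K + K2 + K3} \<times> {- K2..K + K1 + K3} \<times> {- K3..K + K1 + K2}"
  proof
    fix n assume n: "n \<in> {n. F n \<noteq> 0}"
    obtain k l m where klm: "n = (k, l, m)" by (cases n)
    then have "\<not> - k > K1" "\<not> - l > K2" "\<not> - m > K3" "\<not> k + l + m > K"
      using n K1[of k l m] K2[of l k m] K3[of m k l] K[of k l m] by auto
    then show "n \<in> {- K1..K + K2 + K3} \<times> {- K2..K + K1 + K3} \<times> {- K3..K + K1 + K2}"
      by (auto simp: klm)
  qed
  then show ?thesis
    by (rule finite_subset) auto
qed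

definition monomial :: "real \<Rightarrow> real \<Rightarrow> real \<Rightarrow> int \<times> int \<times> int \<Rightarrow> complex" where
  "monomial t1 t2 t3 = (\<lambda>(k, l, m). of_real (t1 powi (- k - 1) * t2 powi (- l - 1) * t3 powi (- m - 1)))"

lemma monomial_shift:
  assumes "t1 > 0" "t2 > 0" "t3 > 0"
  shows "monomial t1 t2 t3 (n + e1) = of_real (1 / t1) * monomial t1 t2 t3 n"
    and "monomial t1 t2 t3 (n + e2) = of_real (1 / t2) * monomial t1 t2 t3 n"
    and "monomial t1 t2 t3 (n + e3) = of_real (1 / t3) * monomial t1 t2 t3 n"
  using assms by (cases n; simp add: monomial_def power_int_diff power_int_minus power_int_add field_simps)+

text \<open>
  A series that becomes a Laurent polynomial after multiplication by powers of \<open>t1 - t2\<close>,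
  \<open>t1 - t3\<close> and \<open>t2 - t3\<close> converges absolutely where \<open>t1 > t2 > t3 > 0\<close>, if it is an expansion in
  that domain.
\<close>

lemma summable_of_polynomial_after_clearing:
  assumes t: "t1 > t2" "t2 > t3" "t3 > 0"
    and van: "dies_along (e2 - e1) F" "dies_along (e3 - e1) F" "dies_along (e3 - e2) F"
    and fin: "finite {n. (diff_op e1 e2 ^^ N) ((diff_op e1 e3 ^^ N) ((diff_op e2 e3 ^^ N) F)) n \<noteq> 0}"
  shows "(\<lambda>n. monomial t1 t2 t3 n * F n) summable_on UNIV"
proof -
  have pos: "t1 > 0" "t2 > 0" "t3 > 0" using t by auto
  note shift = monomial_shift[OF pos]
  have inv12: "0 < 1 / t1" "1 / t1 < 1 / t2" and inv13: "0 < 1 / t1" "1 / t1 < 1 / t3"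
    and inv23: "0 < 1 / t2" "1 / t2 < 1 / t3"
    using t by (auto simp: field_simps)
  have "(\<lambda>n. monomial t1 t2 t3 n *
      (diff_op e1 e2 ^^ N) ((diff_op e1 e3 ^^ N) ((diff_op e2 e3 ^^ N) F)) n) summable_on UNIV"
    using fin by (intro finite_nonzero_values_imp_summable_on) (auto elim: finite_subset[rotated])
  then have "(\<lambda>n. monomial t1 t2 t3 n * (diff_op e1 e3 ^^ N) ((diff_op e2 e3 ^^ N) F) n) summable_on UNIV"
    by (rule summable_of_diff_op_funpow[OF shift(1,2) inv12 dies_along_diff_op_funpow[OF dies_along_diff_op_funpow[OF van(1)]]])
  then have "(\<lambda>n. monomial t1 t2 t3 n * (diff_op e2 e3 ^^ N) F n) summable_on UNIV"
    by (rule summable_of_diff_op_funpow[OF shift(1,3) inv13 dies_along_diff_op_funpow[OF van(2)]])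
  then show ?thesis
    by (rule summable_of_diff_op_funpow[OF shift(2,3) inv23 van(3)])
qed

section \<open>Locality and absolute convergence of three-point series\<close>

definition coef :: "('v, 'm) vosa_scheme \<Rightarrow> ('v \<Rightarrow> complex) \<Rightarrow> 'v \<Rightarrow> 'v \<Rightarrow> 'v \<Rightarrow> 'v \<Rightarrow> int \<times> int \<times> int \<Rightarrow> complex" where
  "coef V \<phi> v A B C = (\<lambda>(k, l, m). \<phi> (mode V A k (mode V B l (mode V C m v))))"

context vertex_operator_superalgebra
begin

abbreviation lin :: "('v \<Rightarrow> 'v) \<Rightarrow> bool" where
  "lin \<equiv> Vector_Spaces.linear (scal V) (scal V)"

abbreviation functional :: "('v \<Rightarrow> complex) \<Rightarrow> bool" where
  "functional \<equiv> Vector_Spaces.linear (scal V) (*)"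

lemma lin_add: "lin T \<Longrightarrow> T (x + y) = T x + T y"
  and lin_scale: "lin T \<Longrightarrow> T (scal V c x) = scal V c (T x)"
  by (simp_all add: Vector_Spaces.linear_def module_hom_def module_hom_axioms_def)

lemma functional_add: "functional \<phi> \<Longrightarrow> \<phi> (x + y) = \<phi> x + \<phi> y"
  and functional_scale: "functional \<phi> \<Longrightarrow> \<phi> (scal V c x) = c * \<phi> x"
  by (simp_all add: Vector_Spaces.linear_def module_hom_def module_hom_axioms_def)

lemma lin_zero: "lin T \<Longrightarrow> T 0 = 0"
  using lin_scale[of T 0 0] by simp

lemma functional_zero: "functional \<phi> \<Longrightarrow> \<phi> 0 = 0"
  using functional_scale[of \<phi> 0 0] by simp

lemma functional_sum: "functional \<phi> \<Longrightarrow> \<phi> (\<Sum>x\<in>S. f x) = (\<Sum>x\<in>S. \<phi> (f x))"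
  by (induction S rule: infinite_finite_induct) (auto simp: functional_zero functional_add)

lemma functional_comp: "functional \<phi> \<Longrightarrow> lin T \<Longrightarrow> functional (\<phi> \<circ> T)"
  using Vector_Spaces.linear_compose[of "scal V" "scal V" T "(*)" \<phi>] by simp

lemmas mode_add_right = lin_add[OF mode_linear_right]
  and mode_scale_right = lin_scale[OF mode_linear_right]
  and mode_zero_right [simp] = lin_zero[OF mode_linear_right]
  and mode_add_left = lin_add[OF mode_linear_left]
  and mode_scale_left = lin_scale[OF mode_linear_left]
  and mode_zero_left [simp] = lin_zero[OF mode_linear_left]

lemma homogeneous_induct [case_names add hom]:
  assumes add: "\<And>x y. P x \<Longrightarrow> P y \<Longrightarrow> P (x + y)"
    and hom: "\<And>i \<mu> x. x \<in> grade V i \<mu> \<Longrightarrow> P x"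
  shows "P v"
proof -
  obtain x where x: "finite {p. x p \<noteq> 0}" "\<forall>i \<mu>. x (i, \<mu>) \<in> grade V i \<mu>" "v = Sum_any x"
    using grade_direct_sum[of v] by blast
  have "P (sum x S)" for S :: "(int \<times> int) set"
  proof (induction S rule: infinite_finite_induct)
    case (insert p S)
    then show ?case
      using hom[OF x(2)[rule_format, of "fst p" "snd p"]] by (simp add: add)
  qed (use hom subspace_0[OF grade_subspace] in auto)
  then show ?thesis
    by (simp add: x(3) Sum_any.expand_set)
qed

lemma fermionic_space_induct [consumes 1, case_names add hom]:
  assumes "A \<in> fermionic_space V \<mu>"
    and add: "\<And>x y. P x \<Longrightarrow> P y \<Longrightarrow> P (x + y)"
    and hom: "\<And>i x. x \<in> grade V i \<mu> \<Longrightarrow> P x"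
  shows "P A"
  using assms(1) unfolding fermionic_space_def
proof (induction rule: span_induct_alt)
  case base
  then show ?case using hom subspace_0[OF grade_subspace] by blast
next
  case (step c x y)
  then show ?case using hom subspace_scale[OF grade_subspace] by (blast intro: add)
qed

lemma grade_subset_weight_space: "x \<in> grade V i \<mu> \<Longrightarrow> x \<in> weight_space V i"
  unfolding weight_space_def by (rule span_base) blast

text \<open>
  The Jacobi identity with both the index of \<open>X\<close> and the exponent of the kernel equal to 0, where
  each of its sums reduces to the term \<open>k = 0\<close>.
\<close>

lemma zero_mode_commutator:
  assumes X: "X \<in> grade V i \<xi>" and A: "A \<in> fermionic_space V \<mu>"
  shows "mode V X 0 (mode V A n w) =
    mode V (mode V X 0 A) n w + scal V ((-1) powi (\<xi> * \<mu>)) (mode V A n (mode V X 0 w))"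
  using A
proof (induction rule: fermionic_space_induct)
  case (add x y)
  then show ?case
    by (simp add: mode_add_left mode_add_right scale_right_distrib add_ac)
next
  case (hom j x)
  have single: "Sum_any (\<lambda>k::nat. if k = 0 then u else 0) = u" for u :: 'v
    by (rule Sum_any.delta)
  have z: "(0 :: complex) gchoose k = (if k = 0 then 1 else 0)" for k
    by (cases k) auto
  have "mode V (mode V X 0 x) n w =
      mode V X 0 (mode V x n w) - scal V ((-1) powi (\<xi> * \<mu>)) (mode V x n (mode V X 0 w))"
    using jacobi[OF X hom, of 0 0 n w]
    by (simp add: z if_distrib[of "\<lambda>c. scal V c _"] if_distrib[of "\<lambda>c. _ * c"] single cong: if_cong)
  then show ?case
    by simp
qed

text \<open>
  The identity \<open>(x - y)^N A(x) B(y) = s (x - y)^N B(y) A(x)\<close>, read off coefficientwise after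
  applying a functional.
\<close>

definition local_of_order :: "nat \<Rightarrow> complex \<Rightarrow> 'v \<Rightarrow> 'v \<Rightarrow> bool" where
  "local_of_order N s A B \<longleftrightarrow> (\<forall>\<psi> p q w. functional \<psi> \<longrightarrow>
    (\<Sum>k\<le>N. (-1) ^ k * of_nat (N choose k) * \<psi> (mode V A (p + int (N - k)) (mode V B (q + int k) w))) =
    s * (\<Sum>k\<le>N. (-1) ^ k * of_nat (N choose k) * \<psi> (mode V B (q + int k) (mode V A (p + int (N - k)) w))))"

text \<open>
  For an exponent \<open>N\<close> so large that \<open>mode V A (N + k) B = 0\<close> for all \<open>k\<close>, the
  iterate side of the Jacobi identity vanishes, and what remains is locality of order \<open>N\<close>. The
  sign \<open>(-1)^N\<close> there is absorbed by reversing the order of summation in the second product.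
\<close>

lemma locality:
  assumes A: "A \<in> grade V i \<mu>" and B: "B \<in> grade V j \<nu>"
  shows "\<exists>N0. \<forall>N\<ge>N0. local_of_order N ((-1) powi (\<mu> * \<nu>)) A B"
proof -
  obtain M where M: "\<forall>n\<ge>M. mode V A n B = 0"
    using truncation by blast
  show ?thesis
    unfolding local_of_order_def
  proof (intro exI allI impI)
    fix N and \<psi> :: "'v \<Rightarrow> complex" and p q w
    assume N: "N \<ge> nat M" and \<psi>: "functional \<psi>"
    define a where "a k = \<psi> (mode V A (p + int (N - k)) (mode V B (q + int k) w))" for k
    define b where "b k = \<psi> (mode V B (q + int (N - k)) (mode V A (p + int k) w))" for k
    have "mode V A (int N + int k) B = 0" for k
      using M N by auto
    then have zero: "0 = Sum_any (\<lambda>k::nat. scal V ((-1) ^ k * (of_int (int N) gchoose k))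
              (mode V A (p + int N - int k) (mode V B (q + int k) w)
               - scal V ((-1) powi (int N + \<mu> * \<nu>))
                   (mode V B (q + int N - int k) (mode V A (p + int k) w))))" (is "0 = Sum_any ?f")
      using jacobi[OF A B, of p "int N" q w] by simp
    have ch: "(of_int (int N) :: complex) gchoose k = of_nat (N choose k)" for k
      by (simp add: binomial_gbinomial)
    have "?f k = 0" if "k > N" for k
      using that unfolding ch by simp
    then have "{k. ?f k \<noteq> 0} \<subseteq> {..N}"
      using not_le by blast
    then have "Sum_any ?f = sum ?f {..N}"
      by (intro Sum_any.expand_superset) auto
    then have "0 = \<psi> (sum ?f {..N})"
      using zero functional_zero[OF \<psi>] by simp
    also have "\<dots> = (\<Sum>k\<le>N. (-1) ^ k * of_nat (N choose k) * (a k - (-1) powi (int N + \<mu> * \<nu>) * b k))"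
      unfolding functional_sum[OF \<psi>]
    proof (intro sum.cong refl)
      fix k assume k: "k \<in> {..N}"
      have diff: "\<psi> (x - scal V c y) = \<psi> x - c * \<psi> y" for x y c
        using functional_add[OF \<psi>, of x "scal V (- c) y"] functional_scale[OF \<psi>, of "- c" y] by simp
      show "\<psi> (?f k) = (-1) ^ k * of_nat (N choose k) * (a k - (-1) powi (int N + \<mu> * \<nu>) * b k)"
        unfolding ch functional_scale[OF \<psi>] diff using k by (simp add: a_def b_def of_nat_diff add_diff_eq)
    qed
    also have "\<dots> = (\<Sum>k\<le>N. (-1) ^ k * of_nat (N choose k) * a k) -
        (\<Sum>k\<le>N. (-1) ^ k * of_nat (N choose k) * ((-1) powi (int N + \<mu> * \<nu>) * b k))"
      by (simp add: sum_subtractf[symmetric] algebra_simps)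
    also have "(\<Sum>k\<le>N. (-1) ^ k * of_nat (N choose k) * ((-1) powi (int N + \<mu> * \<nu>) * b k)) =
        (\<Sum>k\<le>N. (-1) powi (\<mu> * \<nu>) * ((-1) ^ k * of_nat (N choose k) * b (N - k)))"
    proof (rule sum.reindex_bij_witness[where i = "\<lambda>k. N - k" and j = "\<lambda>k. N - k"])
      fix k assume k: "k \<in> {..N}"
      have "(-1 :: complex) ^ (N - k) = (-1) ^ k * (-1) ^ N"
        using k by (simp add: minus_one_power_iff)
      then show "(-1) powi (\<mu> * \<nu>) * ((-1) ^ (N - k) * of_nat (N choose (N - k)) * b (N - (N - k))) =
          (-1) ^ k * of_nat (N choose k) * ((-1) powi (int N + \<mu> * \<nu>) * b k)"
        using k by (simp add: power_int_add binomial_symmetric[of k N])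
    qed auto
    finally show "(\<Sum>k\<le>N. (-1) ^ k * of_nat (N choose k) * \<psi> (mode V A (p + int (N - k)) (mode V B (q + int k) w))) =
        (-1) powi (\<mu> * \<nu>) *
        (\<Sum>k\<le>N. (-1) ^ k * of_nat (N choose k) * \<psi> (mode V B (q + int k) (mode V A (p + int (N - k)) w)))"
      by (simp add: a_def b_def sum_distrib_left)
  qed
qed

text \<open>
  The two inner fields leave a vector of weight bounded below, and \<open>\<phi>\<close> sees only weights bounded
  above. Hence the leftmost mode cannot raise the weight too much.
\<close>

lemma coef_vanishes_left:
  assumes \<phi>: "\<phi> \<in> restricted_dual V" and X: "X \<in> grade V i \<mu>" and Y: "Y \<in> grade V i' \<mu>'"
    and Z: "Z \<in> grade V j \<nu>" and v: "v \<in> grade V j' \<nu>'"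
  shows "\<exists>K. \<forall>k l m. - k > K \<longrightarrow> \<phi> (mode V X k (mode V Y l (mode V Z m v))) = 0"
proof -
  have fin: "finite {i. \<exists>x\<in>weight_space V i. \<phi> x \<noteq> 0}" and lin: "functional \<phi>"
    using \<phi> by (auto simp: restricted_dual_def)
  obtain M where M: "\<And>i x. i > M \<Longrightarrow> x \<in> weight_space V i \<Longrightarrow> \<phi> x = 0"
    using bdd_above_finite[OF fin] unfolding bdd_above_def by (metis (mono_tags, lifting) mem_Collect_eq not_le)
  obtain N where N: "\<And>i. i < N \<Longrightarrow> weight_space V i = {0}"
    using weight_bounded_below by blast
  have "\<phi> (mode V X k (mode V Y l (mode V Z m v))) = 0" if k: "- k > M - N - i + 1" for k l m
  proof -
    let ?w = "i' + (j + j' - m - 1) - l - 1"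
    have y: "mode V Y l (mode V Z m v) \<in> grade V ?w (\<mu>' + (\<nu> + \<nu>'))"
      by (intro mode_grade Y Z v)
    show ?thesis
    proof (cases "?w < N")
      case True
      then have "mode V Y l (mode V Z m v) = 0"
        using grade_subset_weight_space[OF y] N by auto
      then show ?thesis
        using functional_zero[OF lin] by simp
    next
      case False
      show ?thesis
        by (rule M[OF _ grade_subset_weight_space[OF mode_grade[OF X y]]]) (use k False in auto)
    qed
  qed
  then show ?thesis by blast
qed

lemma coef_vanishes_total:
  assumes \<phi>: "functional \<phi>" and X: "X \<in> grade V i \<mu>" and Y: "Y \<in> grade V i' \<mu>'"
    and Z: "Z \<in> grade V j \<nu>" and v: "v \<in> grade V j' \<nu>'"
  shows "\<exists>K. \<forall>k l m. k + l + m > K \<longrightarrow> \<phi> (mode V X k (mode V Y l (mode V Z m v))) = 0"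
proof -
  obtain N where N: "\<And>i. i < N \<Longrightarrow> weight_space V i = {0}"
    using weight_bounded_below by blast
  have "\<phi> (mode V X k (mode V Y l (mode V Z m v))) = 0" if k: "k + l + m > i + i' + j + j' - 3 - N" for k l m
  proof -
    have y: "mode V X k (mode V Y l (mode V Z m v)) \<in> grade V (i + (i' + (j + j' - m - 1) - l - 1) - k - 1)
        (\<mu> + (\<mu>' + (\<nu> + \<nu>')))"
      by (intro mode_grade X Y Z v)
    have "mode V X k (mode V Y l (mode V Z m v)) = 0"
      using grade_subset_weight_space[OF y] N[of "i + (i' + (j + j' - m - 1) - l - 1) - k - 1"] k by auto
    then show ?thesis
      using functional_zero[OF \<phi>] by simp
  qed
  then show ?thesis by blast
qed

text \<open>
  For each field, locality rewrites the cleared series so that this field stands leftmost, which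
  bounds its mode index from below by \<open>coef_vanishes_left\<close>. For \<open>B\<close> one exchange with
  \<open>A\<close> suffices; for \<open>C\<close> it takes an exchange with \<open>B\<close> and one with \<open>A\<close>.
\<close>

lemma coef_clearing:
  assumes \<phi>: "\<phi> \<in> restricted_dual V" and A: "A \<in> grade V i \<mu>" and B: "B \<in> grade V i' \<mu>'"
    and C: "C \<in> grade V j \<nu>" and v: "v \<in> grade V j' \<nu>'"
  shows "\<exists>N. finite {n. (diff_op e1 e2 ^^ N) ((diff_op e1 e3 ^^ N)
    ((diff_op e2 e3 ^^ N) (coef V \<phi> v A B C))) n \<noteq> 0}"
proof -
  have lin: "functional \<phi>"
    using \<phi> by (auto simp: restricted_dual_def)
  have comp: "functional (\<lambda>x. \<phi> (mode V X k x))" for X k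
    using functional_comp[OF lin mode_linear_right[of X k]] by (simp add: o_def)
  obtain N1 where N1: "\<And>N. N \<ge> N1 \<Longrightarrow> local_of_order N ((-1) powi (\<mu> * \<mu>')) A B"
    using locality[OF A B] by blast
  obtain N2 where N2: "\<And>N. N \<ge> N2 \<Longrightarrow> local_of_order N ((-1) powi (\<mu> * \<nu>)) A C"
    using locality[OF A C] by blast
  obtain N3 where N3: "\<And>N. N \<ge> N3 \<Longrightarrow> local_of_order N ((-1) powi (\<mu>' * \<nu>)) B C"
    using locality[OF B C] by blast
  define N where "N = max N1 (max N2 N3)"
  have AB: "local_of_order N ((-1) powi (\<mu> * \<mu>')) A B"
    and AC: "local_of_order N ((-1) powi (\<mu> * \<nu>)) A C"
    and BC: "local_of_order N ((-1) powi (\<mu>' * \<nu>)) B C"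
    by (auto simp: N_def intro: N1 N2 N3)
  note AB = AB[unfolded local_of_order_def, rule_format]
    and AC = AC[unfolded local_of_order_def, rule_format]
    and BC = BC[unfolded local_of_order_def, rule_format]
  let ?D12 = "diff_op e1 e2 ^^ N" and ?D13 = "diff_op e1 e3 ^^ N" and ?D23 = "diff_op e2 e3 ^^ N"
  let ?F = "coef V \<phi> v A B C"
  let ?G = "?D12 (?D13 (?D23 ?F))"
  \<comment> \<open>The letters in \<open>bac\<close>, \<open>acb\<close>, \<open>cab\<close> are the orders of the fields that locality produces.\<close>
  have bac: "?D12 ?F = (\<lambda>n. (-1) powi (\<mu> * \<mu>') *
      ?D12 (\<lambda>(k, l, m). \<phi> (mode V B l (mode V A k (mode V C m v)))) n)"
    using AB[OF lin] by (auto simp: fun_eq_iff diff_op_funpow sum_triple coef_def)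
  have acb: "?D23 ?F = (\<lambda>n. (-1) powi (\<mu>' * \<nu>) *
      ?D23 (\<lambda>(k, l, m). \<phi> (mode V A k (mode V C m (mode V B l v)))) n)"
    using BC[OF comp] by (auto simp: fun_eq_iff diff_op_funpow sum_triple coef_def)
  have cab: "?D13 (\<lambda>(k, l, m). \<phi> (mode V A k (mode V C m (mode V B l v)))) = (\<lambda>n. (-1) powi (\<mu> * \<nu>) *
      ?D13 (\<lambda>(k, l, m). \<phi> (mode V C m (mode V A k (mode V B l v)))) n)"
    using AC[OF lin] by (auto simp: fun_eq_iff diff_op_funpow sum_triple)
  have v1: "vanishes_above (\<lambda>(k, l, m). - k) ?G"
    using coef_vanishes_left[OF \<phi> A B C v]
    by (intro vanishes_above_diff_op_funpow) (auto simp: vanishes_above_def coef_def)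
  have v4: "vanishes_above sum_coords ?G"
    using coef_vanishes_total[OF lin A B C v]
    by (intro vanishes_above_diff_op_funpow) (auto simp: vanishes_above_def coef_def)
  have "?G = ?D13 (?D23 (?D12 ?F))"
    by (simp only: diff_op_funpow_commute[of N e1 e2 N e1 e3] diff_op_funpow_commute[of N e1 e2 N e2 e3])
  moreover have "vanishes_above (\<lambda>(k, l, m). - l) (?D13 (?D23 (?D12 ?F)))"
    using coef_vanishes_left[OF \<phi> B A C v] unfolding bac
    by (intro vanishes_above_diff_op_funpow vanishes_above_scale) (auto simp: vanishes_above_def)
  ultimately have v2: "vanishes_above (\<lambda>(k, l, m). - l) ?G"
    by simp
  have "?G = (\<lambda>n. (-1) powi (\<mu>' * \<nu>) *
      ?D12 (?D23 (?D13 (\<lambda>(k, l, m). \<phi> (mode V A k (mode V C m (mode V B l v)))))) n)"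
    unfolding acb by (simp only: diff_op_funpow_scale diff_op_funpow_commute[of N e1 e3 N e2 e3])
  moreover have "vanishes_above (\<lambda>(k, l, m). - m)
      (?D12 (?D23 (?D13 (\<lambda>(k, l, m). \<phi> (mode V A k (mode V C m (mode V B l v)))))))"
    using coef_vanishes_left[OF \<phi> C A B v] unfolding cab
    by (intro vanishes_above_diff_op_funpow vanishes_above_scale) (auto simp: vanishes_above_def)
  ultimately have v3: "vanishes_above (\<lambda>(k, l, m). - m) ?G"
    by (auto intro: vanishes_above_scale)
  show ?thesis
    using finite_support_of_vanishing[OF v1 v2 v3 v4] by blast
qed

text \<open>
  On homogeneous vectors the series can be cleared of its poles. It is an expansion in the right
  domain: the mode index of \<open>A\<close> is bounded below, as \<open>A\<close> stands leftmost, and that of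
  \<open>C\<close> is bounded above by truncation. Multilinearity gives the general case.
\<close>

lemma coef_summable:
  assumes \<phi>: "\<phi> \<in> restricted_dual V" and t: "t1 > t2" "t2 > t3" "t3 > 0"
  shows "(\<lambda>n. monomial t1 t2 t3 n * coef V \<phi> v A B C n) summable_on UNIV"
proof -
  have lin: "functional \<phi>"
    using \<phi> by (auto simp: restricted_dual_def)
  note expand = coef_def mode_add_left mode_add_right functional_add[OF lin] distrib_left case_prod_unfold
  have "(\<lambda>n. monomial t1 t2 t3 n * coef V \<phi> v A B C n) summable_on UNIV"
    if A: "A \<in> grade V i \<mu>" and B: "B \<in> grade V i' \<mu>'" and C: "C \<in> grade V j \<nu>" and v: "v \<in> grade V j' \<nu>'"
    for A B C v i \<mu> i' \<mu>' j \<nu> j' \<nu>'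
  proof -
    let ?F = "coef V \<phi> v A B C"
    obtain K where K: "\<And>k l m. - k > K \<Longrightarrow> ?F (k, l, m) = 0"
      using coef_vanishes_left[OF \<phi> A B C v] by (auto simp: coef_def)
    obtain M where M: "\<And>m. m \<ge> M \<Longrightarrow> mode V C m v = 0"
      using truncation by blast
    then have M: "\<And>k l m. m \<ge> M \<Longrightarrow> ?F (k, l, m) = 0"
      using functional_zero[OF lin] by (simp add: coef_def)
    have "dies_along (e2 - e1) ?F"
      unfolding dies_along_def
    proof
      fix n :: "int \<times> int \<times> int"
      show "\<exists>J::nat. \<forall>j\<ge>J. ?F (n + (\<Sum>i<j. e2 - e1)) = 0"
        by (cases n, rule exI[of _ "nat (K + fst n + 1)"]) (auto simp: sum_triple intro!: K)
    qed
    moreover have "dies_along (e3 - e1) ?F"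
      unfolding dies_along_def
    proof
      fix n :: "int \<times> int \<times> int"
      show "\<exists>J::nat. \<forall>j\<ge>J. ?F (n + (\<Sum>i<j. e3 - e1)) = 0"
        by (cases n, rule exI[of _ "nat (K + fst n + 1)"]) (auto simp: sum_triple intro!: K)
    qed
    moreover have "dies_along (e3 - e2) ?F"
      unfolding dies_along_def
    proof
      fix n :: "int \<times> int \<times> int"
      show "\<exists>J::nat. \<forall>j\<ge>J. ?F (n + (\<Sum>i<j. e3 - e2)) = 0"
        by (cases n, rule exI[of _ "nat (M - snd (snd n))"]) (auto simp: sum_triple intro!: M)
    qed
    moreover obtain N where "finite {n. (diff_op e1 e2 ^^ N) ((diff_op e1 e3 ^^ N) ((diff_op e2 e3 ^^ N) ?F)) n \<noteq> 0}"
      using coef_clearing[OF \<phi> A B C v] by blast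
    ultimately show ?thesis
      using t by (intro summable_of_polynomial_after_clearing)
  qed
  then have "(\<lambda>n. monomial t1 t2 t3 n * coef V \<phi> v A B C n) summable_on UNIV"
    if "A \<in> grade V i \<mu>" and "B \<in> grade V i' \<mu>'" and "C \<in> grade V j \<nu>"
    for A B C v i \<mu> i' \<mu>' j \<nu>
    using that by (induction v rule: homogeneous_induct) (auto simp: expand intro: summable_on_add)
  then have "(\<lambda>n. monomial t1 t2 t3 n * coef V \<phi> v A B C n) summable_on UNIV"
    if "A \<in> grade V i \<mu>" and "B \<in> grade V i' \<mu>'"
    for A B C v i \<mu> i' \<mu>'
    using that by (induction C rule: homogeneous_induct) (auto simp: expand intro: summable_on_add)
  then have "(\<lambda>n. monomial t1 t2 t3 n * coef V \<phi> v A B C n) summable_on UNIV"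
    if "A \<in> grade V i \<mu>"
    for A B C v i \<mu>
    using that by (induction B rule: homogeneous_induct) (auto simp: expand intro: summable_on_add)
  then show ?thesis
    by (induction A rule: homogeneous_induct) (auto simp: expand intro: summable_on_add)
qed

end

section \<open>Differentiation of the three-point function\<close>

definition three_point ::
  "('v, 'm) vosa_scheme \<Rightarrow> ('v \<Rightarrow> complex) \<Rightarrow> 'v \<Rightarrow> real \<Rightarrow> 'v \<Rightarrow> real \<Rightarrow> 'v \<Rightarrow> real \<Rightarrow> 'v \<Rightarrow> complex" where
  "three_point V \<phi> v t1 A t2 B t3 C = (\<Sum>\<^sub>\<infinity>n. monomial t1 t2 t3 n * coef V \<phi> v A B C n)"

lemma power_int_le_endpoints:
  fixes u :: real
  assumes "0 < a" "a \<le> u" "u \<le> b"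
  shows "u powi k \<le> a powi k + b powi k"
proof (cases "k \<ge> 0")
  case True
  then have "u powi k \<le> b powi k"
    using assms by (simp add: power_int_def power_mono)
  then show ?thesis
    using assms by (smt (verit) zero_le_power_int)
next
  case False
  then have "u powi k \<le> a powi k"
    using assms by (simp add: power_int_def power_mono le_imp_inverse_le)
  then show ?thesis
    using assms by (smt (verit) zero_le_power_int)
qed

lemma norm_monomial:
  assumes "t1 > 0" "t2 > 0" "t3 > 0"
  shows "norm (monomial t1 t2 t3 (k, l, m)) = t1 powi (- k - 1) * t2 powi (- l - 1) * t3 powi (- m - 1)"
  using assms by (simp add: monomial_def norm_mult norm_power_int)

text \<open>
  On a box, each monomial is dominated by the sum of its values at the corners, and at each corner
  the three-point series converges. This gives the dominating series for termwise differentiation.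
\<close>

lemma norm_monomial_le_corners:
  assumes "0 < a1" "a1 \<le> t1" "t1 \<le> b1" and "0 < a2" "a2 \<le> t2" "t2 \<le> b2" and "0 < t3"
  shows "norm (monomial t1 t2 t3 n) \<le> norm (monomial a1 a2 t3 n) + norm (monomial a1 b2 t3 n) +
    norm (monomial b1 a2 t3 n) + norm (monomial b1 b2 t3 n)"
proof -
  obtain k l m where n: "n = (k, l, m)" by (cases n)
  have "t1 powi (- k - 1) * t2 powi (- l - 1) * t3 powi (- m - 1) \<le>
      (a1 powi (- k - 1) + b1 powi (- k - 1)) * (a2 powi (- l - 1) + b2 powi (- l - 1)) * t3 powi (- m - 1)"
    using assms by (intro mult_mono power_int_le_endpoints) (auto intro!: add_nonneg_nonneg mult_nonneg_nonneg)
  then show ?thesis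
    using assms by (simp add: n norm_monomial algebra_simps)
qed

lemma monomial_has_vector_derivative:
  assumes "t1 + x * s > 0" "t2 + y * s > 0"
  shows "((\<lambda>s. monomial (t1 + x * s) (t2 + y * s) t3 (k, l, m) * c) has_vector_derivative
    (of_real x * monomial (t1 + x * s) (t2 + y * s) t3 (k + 1, l, m) * (of_int (- (k + 1)) * c) +
     of_real y * monomial (t1 + x * s) (t2 + y * s) t3 (k, l + 1, m) * (of_int (- (l + 1)) * c))) (at s)"
proof -
  let ?h = "\<lambda>s. (t1 + x * s) powi (- k - 1) * (t2 + y * s) powi (- l - 1) * t3 powi (- m - 1)"
  have "(?h has_field_derivative
      (x * ((t1 + x * s) powi (- (k + 1) - 1) * (t2 + y * s) powi (- l - 1) * t3 powi (- m - 1)) * of_int (- (k + 1)) +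
       y * ((t1 + x * s) powi (- k - 1) * (t2 + y * s) powi (- (l + 1) - 1) * t3 powi (- m - 1)) * of_int (- (l + 1)))) (at s)"
    using assms by (auto intro!: derivative_eq_intros simp: algebra_simps)
  from has_vector_derivative_scaleR[OF this has_vector_derivative_const[of c]]
  have "((\<lambda>s. ?h s *\<^sub>R c) has_vector_derivative
      (x * ((t1 + x * s) powi (- (k + 1) - 1) * (t2 + y * s) powi (- l - 1) * t3 powi (- m - 1)) * of_int (- (k + 1)) +
       y * ((t1 + x * s) powi (- k - 1) * (t2 + y * s) powi (- (l + 1) - 1) * t3 powi (- m - 1)) * of_int (- (l + 1))) *\<^sub>R c) (at s)"
    by simp
  then show ?thesis
    unfolding monomial_def prod.case
    \<comment> \<open>Function and derivative agree with those above only up to the form of the scalar multiplication.\<close>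
    by (rule back_subst[where P = "\<lambda>f. (f has_vector_derivative _) _", THEN back_subst[where P = "\<lambda>d. (_ has_vector_derivative d) _"]])
      (simp_all add: scaleR_conv_of_real algebra_simps)
qed

context vertex_operator_superalgebra
begin

abbreviation L_deriv :: "'v \<Rightarrow> 'v" where "L_deriv \<equiv> L_mode V (-1)"

text \<open>
  The factor produced by differentiating a power is absorbed into \<open>L_{-1}\<close> at the price of
  a shift of the mode index.
\<close>

lemma coef_L_deriv:
  assumes "functional \<phi>"
  shows "coef V \<phi> v (L_deriv A) B C (k + 1, l, m) = of_int (- (k + 1)) * coef V \<phi> v A B C (k, l, m)"
    and "coef V \<phi> v A (L_deriv B) C (k, l + 1, m) = of_int (- (l + 1)) * coef V \<phi> v A B C (k, l, m)"
  using L_derivative[of A "k + 1"] L_derivative[of B "l + 1"]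
  by (simp_all add: coef_def functional_scale[OF assms] mode_scale_right)

lemma shifted_summable:
  assumes \<phi>: "\<phi> \<in> restricted_dual V" and t: "t1 > t2" "t2 > t3" "t3 > 0"
  shows "(\<lambda>n. norm (monomial t1 t2 t3 (n + e) * coef V \<phi> v A B C (n + e))) summable_on UNIV"
proof -
  have "bij (\<lambda>n. n + e)"
    by (rule o_bij[where g = "\<lambda>n. n - e"]) auto
  from summable_on_reindex_bij_betw[OF this, of "\<lambda>n. norm (monomial t1 t2 t3 n * coef V \<phi> v A B C n)"]
  show ?thesis
    using coef_summable[OF assms] by (simp add: summable_on_iff_abs_summable_on_complex)
qed

lemma three_point_shift:
  "three_point V \<phi> v t1 A t2 B t3 C = (\<Sum>\<^sub>\<infinity>n. monomial t1 t2 t3 (n + e) * coef V \<phi> v A B C (n + e))"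
proof -
  have "bij (\<lambda>n. n + e)"
    by (rule o_bij[where g = "\<lambda>n. n - e"]) auto
  from infsum_reindex_bij_betw[OF this, of "\<lambda>n. monomial t1 t2 t3 n * coef V \<phi> v A B C n"]
  show ?thesis
    by (simp add: three_point_def)
qed

text \<open>
  The slopes \<open>x\<close>, \<open>y\<close> cover both paths of integration: one on which only \<open>B\<close> moves, and one on
  which \<open>A\<close> and \<open>B\<close> move at constant distance.
\<close>

lemma three_point_has_vector_derivative_0:
  assumes \<phi>: "\<phi> \<in> restricted_dual V" and t: "t1 > t2" "t2 > t3" "t3 > 0"
  shows "((\<lambda>s. three_point V \<phi> v (t1 + x * s) A (t2 + y * s) B t3 C) has_vector_derivative
    (of_real x * three_point V \<phi> v t1 (L_deriv A) t2 B t3 C +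
     of_real y * three_point V \<phi> v t1 A t2 (L_deriv B) t3 C)) (at 0)"
proof -
  have lin: "functional \<phi>"
    using \<phi> by (auto simp: restricted_dual_def)
  \<comment> \<open>A third of the smaller gap keeps the arguments ordered at all corners of the box.\<close>
  define \<delta> where "\<delta> = min (t1 - t2) (t2 - t3) / 3"
  define r where "r = \<delta> / (\<bar>x\<bar> + \<bar>y\<bar> + 1)"
  have "\<delta> > 0" "\<delta> \<le> (t1 - t2) / 3" "\<delta> \<le> (t2 - t3) / 3"
    using t by (auto simp: \<delta>_def min_def field_simps)
  then have \<delta>: "\<delta> > 0" "t1 - \<delta> > t2 + \<delta>" "t2 - \<delta> > t3"
    using t by (auto simp: field_simps)
  have r: "r > 0"
    using \<delta> by (simp add: r_def add_nonneg_pos)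
  have near: "\<bar>x * s\<bar> \<le> \<delta>" "\<bar>y * s\<bar> \<le> \<delta>" if "\<bar>s\<bar> < r" for s
  proof -
    have "(\<bar>x\<bar> + \<bar>y\<bar> + 1) * \<bar>s\<bar> \<le> \<delta>"
      using that by (simp add: r_def field_simps add_nonneg_pos less_imp_le)
    then show "\<bar>x * s\<bar> \<le> \<delta>" "\<bar>y * s\<bar> \<le> \<delta>"
      by (simp_all add: abs_mult algebra_simps)
        (smt (verit) abs_ge_zero mult_nonneg_nonneg)+
  qed
  define G where "G s n =
      of_real x * (monomial (t1 + x * s) (t2 + y * s) t3 (n + e1) * coef V \<phi> v (L_deriv A) B C (n + e1)) +
      of_real y * (monomial (t1 + x * s) (t2 + y * s) t3 (n + e2) * coef V \<phi> v A (L_deriv B) C (n + e2))"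
    for s n
  define corners where "corners e X Y n =
      norm (monomial (t1 - \<delta>) (t2 - \<delta>) t3 (n + e) * coef V \<phi> v X Y C (n + e)) +
      norm (monomial (t1 - \<delta>) (t2 + \<delta>) t3 (n + e) * coef V \<phi> v X Y C (n + e)) +
      norm (monomial (t1 + \<delta>) (t2 - \<delta>) t3 (n + e) * coef V \<phi> v X Y C (n + e)) +
      norm (monomial (t1 + \<delta>) (t2 + \<delta>) t3 (n + e) * coef V \<phi> v X Y C (n + e))" for e X Y n
  have corners_summable: "corners e X Y summable_on UNIV" for e X Y
    unfolding corners_def using \<delta> t by (intro summable_on_add shifted_summable \<phi>) auto
  have corners_bound: "norm (monomial (t1 + x * s) (t2 + y * s) t3 (n + e) * coef V \<phi> v X Y C (n + e)) \<le> corners e X Y n"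
    if "\<bar>s\<bar> < r" for s n e X Y
  proof -
    have "norm (monomial (t1 + x * s) (t2 + y * s) t3 (n + e)) \<le>
        norm (monomial (t1 - \<delta>) (t2 - \<delta>) t3 (n + e)) + norm (monomial (t1 - \<delta>) (t2 + \<delta>) t3 (n + e)) +
        norm (monomial (t1 + \<delta>) (t2 - \<delta>) t3 (n + e)) + norm (monomial (t1 + \<delta>) (t2 + \<delta>) t3 (n + e))"
      using near[OF that] \<delta> t by (intro norm_monomial_le_corners) (auto simp: abs_le_iff)
    from mult_right_mono[OF this, of "norm (coef V \<phi> v X Y C (n + e))"] show ?thesis
      by (simp add: corners_def norm_mult algebra_simps)
  qed
  have ordered: "t1 + x * s > t2 + y * s" "t2 + y * s > t3" if "\<bar>s\<bar> < r" for s
    using near[OF that] \<delta> by (auto simp: abs_le_iff)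
  have "((\<lambda>s. \<Sum>\<^sub>\<infinity>n. monomial (t1 + x * s) (t2 + y * s) t3 n * coef V \<phi> v A B C n)
      has_vector_derivative infsum (G 0) UNIV) (at 0)"
  proof (rule has_vector_derivative_infsum[where r = r and g = "\<lambda>n s. G s n"
        and M = "\<lambda>n. \<bar>x\<bar> * corners e1 (L_deriv A) B n + \<bar>y\<bar> * corners e2 A (L_deriv B) n"])
    show "infinite (UNIV :: (int \<times> int \<times> int) set)"
      by (simp add: finite_prod infinite_UNIV_int)
    show "((\<lambda>s. monomial (t1 + x * s) (t2 + y * s) t3 n * coef V \<phi> v A B C n) has_vector_derivative G s n) (at s)"
      if "\<bar>s\<bar> < r" for n s
    proof -
      obtain k l m where n: "n = (k, l, m)" by (cases n)
      show ?thesis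
        using monomial_has_vector_derivative[of t1 x s t2 y t3 k l m "coef V \<phi> v A B C n"] ordered[OF that] t
        by (simp add: n G_def coef_L_deriv[OF lin] mult.assoc)
    qed
    show "norm (G s n) \<le> \<bar>x\<bar> * corners e1 (L_deriv A) B n + \<bar>y\<bar> * corners e2 A (L_deriv B) n"
      if "\<bar>s\<bar> < r" for n s
      unfolding G_def
      by (rule norm_triangle_le, rule add_mono;
          subst norm_mult; simp only: norm_of_real; intro mult_left_mono corners_bound that abs_ge_zero)
    show "(\<lambda>n. \<bar>x\<bar> * corners e1 (L_deriv A) B n + \<bar>y\<bar> * corners e2 A (L_deriv B) n) summable_on UNIV"
      by (intro summable_on_add summable_on_cmult_right corners_summable)
    show "(\<lambda>n. monomial (t1 + x * s) (t2 + y * s) t3 n * coef V \<phi> v A B C n) summable_on UNIV" if "\<bar>s\<bar> < r" for s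
      using ordered[OF that] t by (intro coef_summable \<phi>)
  qed (rule r)
  moreover have "infsum (G 0) UNIV = of_real x * three_point V \<phi> v t1 (L_deriv A) t2 B t3 C +
     of_real y * three_point V \<phi> v t1 A t2 (L_deriv B) t3 C"
  proof -
    have sm: "(\<lambda>n. monomial t1 t2 t3 (n + e) * coef V \<phi> v X Y C (n + e)) summable_on UNIV" for e X Y
      using shifted_summable[OF \<phi> t] by (simp add: summable_on_iff_abs_summable_on_complex)
    show ?thesis
      unfolding G_def three_point_shift[where e = e1 and B = B] three_point_shift[where e = e2 and A = A]
      by (simp add: infsum_add infsum_cmult_right sm summable_on_cmult_right)
  qed
  ultimately show ?thesis
    by (simp add: three_point_def)
qed

lemma three_point_has_vector_derivative:
  assumes \<phi>: "\<phi> \<in> restricted_dual V" and t: "p + x * s > q + y * s" "q + y * s > t3" "t3 > 0"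
  shows "((\<lambda>s. three_point V \<phi> v (p + x * s) A (q + y * s) B t3 C) has_vector_derivative
    (of_real x * three_point V \<phi> v (p + x * s) (L_deriv A) (q + y * s) B t3 C +
     of_real y * three_point V \<phi> v (p + x * s) A (q + y * s) (L_deriv B) t3 C)) (at s)"
proof -
  have "((\<lambda>u. u - s) has_vector_derivative 1) (at s)"
    by (auto intro!: derivative_eq_intros)
  from vector_diff_chain_at[OF this, of
      "\<lambda>u. three_point V \<phi> v ((p + x * s) + x * u) A ((q + y * s) + y * u) B t3 C"]
    three_point_has_vector_derivative_0[OF \<phi> t, of v x A y B C]
  show ?thesis
    by (simp add: o_def algebra_simps)
qed

lemma three_point_continuous:
  assumes \<phi>: "\<phi> \<in> restricted_dual V" and "\<And>s. s \<in> S \<Longrightarrow> p + x * s > q + y * s"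
    "\<And>s. s \<in> S \<Longrightarrow> q + y * s > r" "r > 0"
  shows "continuous_on S (\<lambda>s. three_point V \<phi> v (p + x * s) A (q + y * s) B r C)"
  by (intro continuous_at_imp_continuous_on ballI)
    (rule has_vector_derivative_continuous[OF three_point_has_vector_derivative[OF assms]])

end

section \<open>Zero modes inside words\<close>

definition vertex_series :: "('v, 'm) vosa_scheme \<Rightarrow> 'v \<Rightarrow> real \<Rightarrow> int \<Rightarrow> 'v \<Rightarrow> 'v" where
  "vertex_series V A t = (\<lambda>n v. scal V (complex_of_real t powi (- n - 1)) (mode V A n v))"

lemma vertex_op_eq_Factor: "vertex_op V A t = Factor (vertex_series V A t)"
  by (simp add: vertex_op_def vertex_series_def)

lemma sign_cases: "(-1 :: complex) powi k = 1 \<or> (-1 :: complex) powi k = - 1"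
  by (cases "even k") simp_all

context vertex_operator_superalgebra
begin

lemma linI:
  assumes "\<And>x y. T (x + y) = T x + T y" "\<And>c x. T (scal V c x) = scal V c (T x)"
  shows "lin T"
  using assms vector_space_axioms module_axioms
  by (simp add: Vector_Spaces.linear_def module_hom_def module_hom_axioms_def)

lemma lin_vertex_series: "lin (vertex_series V A t k)"
  by (intro linI) (simp_all add: vertex_series_def mode_add_right mode_scale_right scale_right_distrib mult.commute)

lemma lin_endo_series: "lin T \<Longrightarrow> lin (endo_series T k)"
  by (intro linI) (simp_all add: endo_series_def lin_add lin_scale)

lemma lin_word_term:
  assumes "\<forall>g\<in>set u. \<forall>k. lin (g k)"
  shows "lin (word_term u ku)"
  using assms
proof (induction u arbitrary: ku)
  case Nil
  then show ?case by (intro linI) simp_all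
next
  case (Cons g u)
  show ?case
  proof (cases ku)
    case Nil
    then show ?thesis by (intro linI) (simp_all add: word_term_def)
  next
    case (Cons k ks)
    with Cons.IH[of ks] Cons.prems show ?thesis
      by (intro linI) (simp_all add: lin_add lin_scale)
  qed
qed

lemma word_has_sum_three_point:
  assumes \<phi>: "\<phi> \<in> restricted_dual V" and t: "t1 > t2" "t2 > t3" "t3 > 0"
  shows "word_has_sum \<phi> v [vertex_series V A t1, vertex_series V B t2, vertex_series V C t3]
    (three_point V \<phi> v t1 A t2 B t3 C)"
proof -
  have lin: "functional \<phi>"
    using \<phi> by (auto simp: restricted_dual_def)
  have "((\<lambda>n. monomial t1 t2 t3 n * coef V \<phi> v A B C n) has_sum three_point V \<phi> v t1 A t2 B t3 C) UNIV"
    unfolding three_point_def using coef_summable[OF \<phi> t] by (rule has_sum_infsum)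
  also have "(\<lambda>n. monomial t1 t2 t3 n * coef V \<phi> v A B C n) = (\<lambda>(k, l, m).
      \<phi> (vertex_series V A t1 k (vertex_series V B t2 l (vertex_series V C t3 m v))))"
    by (auto simp: fun_eq_iff monomial_def coef_def vertex_series_def mode_scale_right functional_scale[OF lin] of_real_power_int)
  finally show ?thesis
    by (simp add: word_has_sum_three)
qed

lemma word_has_sum_zero_mode_commute:
  assumes \<phi>: "functional \<phi>" and u: "\<forall>g\<in>set u. \<forall>k. lin (g k)"
    and X: "X \<in> grade V i \<xi>" and A: "A \<in> fermionic_space V \<mu>"
    and S1: "word_has_sum \<phi> v (u @ vertex_series V (mode V X 0 A) t # w) S1"
    and S2: "word_has_sum \<phi> v (u @ vertex_series V A t # endo_series (mode V X 0) # w) S2"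
  shows "word_has_sum \<phi> v (u @ endo_series (mode V X 0) # vertex_series V A t # w)
    (S1 + (-1) powi (\<xi> * \<mu>) * S2)"
proof (rule word_has_sum_commute[OF _ _ _ _ S1 S2])
  show "\<phi> 0 = 0" by (rule functional_zero[OF \<phi>])
  show "\<forall>g\<in>set u. \<forall>k. g k 0 = 0" "\<forall>k. vertex_series V A t k 0 = 0"
    using u lin_vertex_series lin_zero by blast+
  fix ku k x
  have "mode V X 0 (vertex_series V A t k x) = vertex_series V (mode V X 0 A) t k x +
      scal V ((-1) powi (\<xi> * \<mu>)) (vertex_series V A t k (mode V X 0 x))"
    by (simp add: vertex_series_def mode_scale_right zero_mode_commutator[OF X A] scale_right_distrib mult.commute)
  then show "\<phi> (word_term u ku (mode V X 0 (vertex_series V A t k x))) =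
      \<phi> (word_term u ku (vertex_series V (mode V X 0 A) t k x)) +
      (-1) powi (\<xi> * \<mu>) * \<phi> (word_term u ku (vertex_series V A t k (mode V X 0 x)))"
    by (simp add: lin_add[OF lin_word_term[OF u]] lin_scale[OF lin_word_term[OF u]]
        functional_add[OF \<phi>] functional_scale[OF \<phi>])
qed

text \<open>
  In the words the operator stands after the second, after the first, or before the first field.
  It is moved to the right end, where it acts on \<open>v\<close>; each value \<open>Wi\<close> is obtained from the next
  one by one commutation.
\<close>

lemma zero_mode_words:
  fixes v :: 'v
  assumes \<phi>: "\<phi> \<in> restricted_dual V" and t: "t1 > t2" "t2 > t3" "t3 > 0"
    and X: "X \<in> grade V i \<xi>"
    and A: "A \<in> fermionic_space V a" and B: "B \<in> fermionic_space V b" and C: "C \<in> fermionic_space V c"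
  defines "W4 \<equiv> three_point V \<phi> (mode V X 0 v) t1 A t2 B t3 C"
  defines "W3 \<equiv> three_point V \<phi> v t1 A t2 B t3 (mode V X 0 C) + (-1) powi (\<xi> * c) * W4"
  defines "W2 \<equiv> three_point V \<phi> v t1 A t2 (mode V X 0 B) t3 C + (-1) powi (\<xi> * b) * W3"
  defines "W1 \<equiv> three_point V \<phi> v t1 (mode V X 0 A) t2 B t3 C + (-1) powi (\<xi> * a) * W2"
  shows "word_has_sum \<phi> v
      [vertex_series V A t1, vertex_series V B t2, endo_series (mode V X 0), vertex_series V C t3] W3"
    and "word_has_sum \<phi> v
      [vertex_series V A t1, endo_series (mode V X 0), vertex_series V B t2, vertex_series V C t3] W2"
    and "word_has_sum \<phi> v
      [endo_series (mode V X 0), vertex_series V A t1, vertex_series V B t2, vertex_series V C t3] W1"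
proof -
  have lin: "functional \<phi>"
    using \<phi> by (auto simp: restricted_dual_def)
  let ?T = "endo_series (mode V X 0)"
  note std = word_has_sum_three_point[OF \<phi> t]
  have zero: "\<phi> 0 = 0" "\<forall>g\<in>set [vertex_series V A t1, vertex_series V B t2, vertex_series V C t3]. \<forall>k. g k 0 = 0"
    using functional_zero[OF lin] lin_zero[OF lin_vertex_series] by auto
  note snoc = word_endo_snoc[where \<phi> = \<phi> and v = v and T = "mode V X 0"
      and w = "[vertex_series V A t1, vertex_series V B t2, vertex_series V C t3]", OF zero]
  have "word_has_sum \<phi> v ([vertex_series V A t1, vertex_series V B t2, vertex_series V C t3] @ [?T]) W4"
    using std[of "mode V X 0 v" A B C] snoc
    by (simp only: word_has_sum_iff W4_def)
  then have 4: "word_has_sum \<phi> v ([vertex_series V A t1, vertex_series V B t2] @ vertex_series V C t3 # [?T]) W4"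
    by simp
  have "word_has_sum \<phi> v ([vertex_series V A t1, vertex_series V B t2] @ ?T # vertex_series V C t3 # []) W3"
    unfolding W3_def using std lin_vertex_series
    by (intro word_has_sum_zero_mode_commute[OF lin _ X C _ 4]) auto
  then show 3: "word_has_sum \<phi> v [vertex_series V A t1, vertex_series V B t2, ?T, vertex_series V C t3] W3"
    by simp
  have "word_has_sum \<phi> v ([vertex_series V A t1] @ ?T # vertex_series V B t2 # [vertex_series V C t3]) W2"
    unfolding W2_def using std lin_vertex_series 3
    by (intro word_has_sum_zero_mode_commute[OF lin _ X B]) auto
  then show 2: "word_has_sum \<phi> v [vertex_series V A t1, ?T, vertex_series V B t2, vertex_series V C t3] W2"
    by simp
  have "word_has_sum \<phi> v ([] @ ?T # vertex_series V A t1 # [vertex_series V B t2, vertex_series V C t3]) W1"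
    unfolding W1_def using std 2
    by (intro word_has_sum_zero_mode_commute[OF lin _ X A]) auto
  then show "word_has_sum \<phi> v [?T, vertex_series V A t1, vertex_series V B t2, vertex_series V C t3] W1"
    by simp
qed

lemma mode_fermionic_space:
  assumes X: "X \<in> grade V i \<xi>" and A: "A \<in> fermionic_space V \<mu>"
  shows "mode V X n A \<in> fermionic_space V (\<mu> + \<xi>)"
  using A
proof (induction rule: fermionic_space_induct)
  case (add x y)
  then show ?case
    unfolding fermionic_space_def by (simp add: mode_add_right span_add)
next
  case (hom j x)
  have "mode V X n x \<in> grade V (i + j - n - 1) (\<mu> + \<xi>)"
    using mode_grade[OF X hom] by (simp add: add.commute)
  then show ?case
    unfolding fermionic_space_def by (intro span_base) blast
qed

text \<open>
  A mode of a homogeneous element shifts all weights by a fixed amount.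
\<close>

lemma restricted_dual_comp_mode:
  assumes \<phi>: "\<phi> \<in> restricted_dual V" and X: "X \<in> grade V i \<xi>"
  shows "\<phi> \<circ> mode V X n \<in> restricted_dual V"
proof -
  have lin: "functional \<phi>" and fin: "finite {j. \<exists>x\<in>weight_space V j. \<phi> x \<noteq> 0}"
    using \<phi> by (auto simp: restricted_dual_def)
  have maps: "mode V X n x \<in> weight_space V (i + j - n - 1)" if "x \<in> weight_space V j" for x j
    using that unfolding weight_space_def[of V j]
  proof (induction rule: span_induct_alt)
    case base
    then show ?case by (simp add: weight_space_def span_zero)
  next
    case (step c x y)
    then obtain \<mu> where x: "x \<in> grade V j \<mu>" by blast
    have "mode V X n x \<in> weight_space V (i + j - n - 1)"
      by (rule grade_subset_weight_space[OF mode_grade[OF X x]])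
    with step show ?case
      by (simp add: mode_add_right mode_scale_right weight_space_def span_add span_scale)
  qed
  have "{j. \<exists>x\<in>weight_space V j. \<phi> (mode V X n x) \<noteq> 0} \<subseteq>
      (\<lambda>j. j - i + n + 1) ` {j. \<exists>x\<in>weight_space V j. \<phi> x \<noteq> 0}"
  proof
    fix j assume "j \<in> {j. \<exists>x\<in>weight_space V j. \<phi> (mode V X n x) \<noteq> 0}"
    then have "i + j - n - 1 \<in> {j. \<exists>x\<in>weight_space V j. \<phi> x \<noteq> 0}"
      using maps by blast
    then show "j \<in> (\<lambda>j. j - i + n + 1) ` {j. \<exists>x\<in>weight_space V j. \<phi> x \<noteq> 0}"
      by (rule rev_image_eqI) simp
  qed
  then have "finite {j. \<exists>x\<in>weight_space V j. \<phi> (mode V X n x) \<noteq> 0}"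
    using fin finite_subset finite_imageI by blast
  then show ?thesis
    using functional_comp[OF lin mode_linear_right[of X n]] by (simp add: restricted_dual_def)
qed

text \<open>
  The word that begins with the zero mode has two evaluations: by absorbing the zero mode into
  \<open>\<phi>\<close>, and by moving it to the right end.
\<close>

lemma three_point_Ward:
  assumes \<phi>: "\<phi> \<in> restricted_dual V" and t: "t1 > t2" "t2 > t3" "t3 > 0"
    and X: "X \<in> grade V i \<xi>"
    and A: "A \<in> fermionic_space V a" and B: "B \<in> fermionic_space V b" and C: "C \<in> fermionic_space V c"
  shows "three_point V (\<phi> \<circ> mode V X 0) v t1 A t2 B t3 C =
    three_point V \<phi> v t1 (mode V X 0 A) t2 B t3 C +
    (-1) powi (\<xi> * a) * (three_point V \<phi> v t1 A t2 (mode V X 0 B) t3 C +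
    (-1) powi (\<xi> * b) * (three_point V \<phi> v t1 A t2 B t3 (mode V X 0 C) +
    (-1) powi (\<xi> * c) * three_point V \<phi> (mode V X 0 v) t1 A t2 B t3 C))"
proof -
  have "\<phi> 0 = 0"
    using \<phi> functional_zero by (auto simp: restricted_dual_def)
  then show ?thesis
    using zero_mode_words(3)[OF \<phi> t X A B C, of v]
      word_has_sum_three_point[OF restricted_dual_comp_mode[OF \<phi> X, of 0] t, of v A B C]
    by (simp add: word_has_sum_iff word_endo_Cons)
qed

lemma three_point_add:
  assumes \<phi>: "\<phi> \<in> restricted_dual V" and t: "t1 > t2" "t2 > t3" "t3 > 0"
  shows "three_point V \<phi> v t1 (A + A') t2 B t3 C = three_point V \<phi> v t1 A t2 B t3 C + three_point V \<phi> v t1 A' t2 B t3 C"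
    and "three_point V \<phi> v t1 A t2 (B + B') t3 C = three_point V \<phi> v t1 A t2 B t3 C + three_point V \<phi> v t1 A t2 B' t3 C"
proof -
  have lin: "functional \<phi>"
    using \<phi> by (auto simp: restricted_dual_def)
  note s = coef_summable[OF \<phi> t]
  show "three_point V \<phi> v t1 (A + A') t2 B t3 C = three_point V \<phi> v t1 A t2 B t3 C + three_point V \<phi> v t1 A' t2 B t3 C"
    unfolding three_point_def infsum_add[OF s s, symmetric]
    by (intro infsum_cong)
      (simp add: coef_def mode_add_left mode_add_right functional_add[OF lin] distrib_left case_prod_unfold)
  show "three_point V \<phi> v t1 A t2 (B + B') t3 C = three_point V \<phi> v t1 A t2 B t3 C + three_point V \<phi> v t1 A t2 B' t3 C"
    unfolding three_point_def infsum_add[OF s s, symmetric]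
    by (intro infsum_cong)
      (simp add: coef_def mode_add_left mode_add_right functional_add[OF lin] distrib_left case_prod_unfold)
qed

end

section \<open>The homotopy formula\<close>

context topological_vertex_operator_algebra
begin

abbreviation \<beta> :: "'v \<Rightarrow> 'v" where "\<beta> \<equiv> b_mode V (-1)"

text \<open>
  Matrix elements of the integrands of \<open>n'_op\<close> and of the pairing of \<open>m_op\<close> with \<open>C\<close>, once the
  bracket with \<open>b_{-1}\<close> has been carried out.
\<close>

definition n'_density ::
  "real \<Rightarrow> real \<Rightarrow> ('v \<Rightarrow> complex) \<Rightarrow> 'v \<Rightarrow> int \<Rightarrow> 'v \<Rightarrow> 'v \<Rightarrow> 'v \<Rightarrow> real \<Rightarrow> complex" where
  "n'_density t \<rho> \<phi> v a A B C s =
    (-1) powi a * three_point V \<phi> v (t + \<rho>) A (t + s) (\<beta> B) t C"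

definition m_density ::
  "real \<Rightarrow> real \<Rightarrow> real \<Rightarrow> ('v \<Rightarrow> complex) \<Rightarrow> 'v \<Rightarrow> int \<Rightarrow> 'v \<Rightarrow> 'v \<Rightarrow> 'v \<Rightarrow> real \<Rightarrow> complex" where
  "m_density t \<rho> \<alpha> \<phi> v a A B C s =
    three_point V \<phi> v (t + \<rho> + \<alpha> + s) (\<beta> A) (t + \<rho> + s) B t C +
    (-1) powi a * three_point V \<phi> v (t + \<rho> + \<alpha> + s) A (t + \<rho> + s) (\<beta> B) t C"

lemma \<beta>_eq: "\<beta> = mode V (b_elem V) 0"
  by (simp add: b_mode_def fun_eq_iff)

lemma Q_eq: "Q_op V = mode V (J_elem V) 0"
  by (simp add: Q_op_def)

lemma lin_\<beta>: "lin \<beta>"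
  using mode_linear_right[of "b_elem V" 0] by (simp add: \<beta>_eq)

lemma n_op_expr_value:
  "expr_value (n_op V \<rho> \<alpha>\<^sub>1 \<alpha>\<^sub>2 a A b B C t) f =
    integral {\<alpha>\<^sub>2..\<rho> - \<alpha>\<^sub>1} (\<lambda>s. (-1) powi a *
      (f [vertex_series V A (t + \<rho>), endo_series \<beta>, vertex_series V B (s + t), vertex_series V C t]
       - (-1) powi (-b) *
         f [vertex_series V A (t + \<rho>), vertex_series V B (s + t), endo_series \<beta>, vertex_series V C t])) +
    integral {- \<alpha>\<^sub>1..0} (\<lambda>s.
      f [endo_series \<beta>, vertex_series V A (s + (t + \<rho>) + \<alpha>\<^sub>1), vertex_series V B (s + (t + \<rho>)), vertex_series V C t]
       - (-1) powi (-(a + b)) *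
         f [vertex_series V A (s + (t + \<rho>) + \<alpha>\<^sub>1), vertex_series V B (s + (t + \<rho>)), endo_series \<beta>, vertex_series V C t])"
  by (simp add: n_op_def n'_op_def pairing_def m_op_def b_bracket_def supercomm_def Minus_def
      vertex_op_eq_Factor endo_eq_Factor)

lemma n_op_expr_defined:
  "expr_defined (n_op V \<rho> \<alpha>\<^sub>1 \<alpha>\<^sub>2 a A b B C t) D f \<longleftrightarrow>
    (\<alpha>\<^sub>2 \<le> \<rho> - \<alpha>\<^sub>1 \<and>
     (\<forall>s\<in>{\<alpha>\<^sub>2..\<rho> - \<alpha>\<^sub>1}.
       D [vertex_series V A (t + \<rho>), endo_series \<beta>, vertex_series V B (s + t), vertex_series V C t] \<and>
       D [vertex_series V A (t + \<rho>), vertex_series V B (s + t), endo_series \<beta>, vertex_series V C t]) \<and>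
     (\<lambda>s. (-1) powi a *
      (f [vertex_series V A (t + \<rho>), endo_series \<beta>, vertex_series V B (s + t), vertex_series V C t]
       - (-1) powi (-b) *
         f [vertex_series V A (t + \<rho>), vertex_series V B (s + t), endo_series \<beta>, vertex_series V C t]))
       absolutely_integrable_on {\<alpha>\<^sub>2..\<rho> - \<alpha>\<^sub>1}) \<and>
    (- \<alpha>\<^sub>1 \<le> 0 \<and>
     (\<forall>s\<in>{- \<alpha>\<^sub>1..0}.
       D [endo_series \<beta>, vertex_series V A (s + (t + \<rho>) + \<alpha>\<^sub>1), vertex_series V B (s + (t + \<rho>)), vertex_series V C t] \<and>
       D [vertex_series V A (s + (t + \<rho>) + \<alpha>\<^sub>1), vertex_series V B (s + (t + \<rho>)), endo_series \<beta>, vertex_series V C t]) \<and>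
     (\<lambda>s.
      f [endo_series \<beta>, vertex_series V A (s + (t + \<rho>) + \<alpha>\<^sub>1), vertex_series V B (s + (t + \<rho>)), vertex_series V C t]
       - (-1) powi (-(a + b)) *
         f [vertex_series V A (s + (t + \<rho>) + \<alpha>\<^sub>1), vertex_series V B (s + (t + \<rho>)), endo_series \<beta>, vertex_series V C t])
       absolutely_integrable_on {- \<alpha>\<^sub>1..0})"
  by (simp add: n_op_def n'_op_def pairing_def m_op_def b_bracket_def supercomm_def Minus_def
      vertex_op_eq_Factor endo_eq_Factor)

text \<open>
  Absorbing an operator that stands to the right of a word relies on all factors of
  the word preserving zero, as those in the words of \<open>n_op\<close> do.
\<close>

lemma n_op_cong:
  assumes "\<And>w. (\<forall>g\<in>set w. \<forall>k. lin (g k)) \<Longrightarrow> f w = f' w"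
    and "\<And>w. (\<forall>g\<in>set w. \<forall>k. lin (g k)) \<Longrightarrow> D w = D' w"
  shows "expr_value (n_op V \<rho> \<alpha>\<^sub>1 \<alpha>\<^sub>2 a A b B C t) f = expr_value (n_op V \<rho> \<alpha>\<^sub>1 \<alpha>\<^sub>2 a A b B C t) f'"
    and "expr_defined (n_op V \<rho> \<alpha>\<^sub>1 \<alpha>\<^sub>2 a A b B C t) D f = expr_defined (n_op V \<rho> \<alpha>\<^sub>1 \<alpha>\<^sub>2 a A b B C t) D' f'"
  unfolding n_op_expr_value n_op_expr_defined
  by (simp_all add: assms lin_vertex_series lin_endo_series lin_\<beta>)

lemma Q_bracket_n_op:
  assumes \<phi>: "functional \<phi>"
  shows "matrix_element \<phi> (Q_bracket V q (n_op V \<rho> \<alpha>\<^sub>1 \<alpha>\<^sub>2 a A b B C t)) v =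
      matrix_element (\<phi> \<circ> Q_op V) (n_op V \<rho> \<alpha>\<^sub>1 \<alpha>\<^sub>2 a A b B C t) v -
      (-1) powi q * matrix_element \<phi> (n_op V \<rho> \<alpha>\<^sub>1 \<alpha>\<^sub>2 a A b B C t) (Q_op V v)"
    and "expr_defined (Q_bracket V q (n_op V \<rho> \<alpha>\<^sub>1 \<alpha>\<^sub>2 a A b B C t)) (word_defined \<phi> v) (word_value \<phi> v) \<longleftrightarrow>
      expr_defined (n_op V \<rho> \<alpha>\<^sub>1 \<alpha>\<^sub>2 a A b B C t) (word_defined (\<phi> \<circ> Q_op V) v) (word_value (\<phi> \<circ> Q_op V) v) \<and>
      expr_defined (n_op V \<rho> \<alpha>\<^sub>1 \<alpha>\<^sub>2 a A b B C t) (word_defined \<phi> (Q_op V v)) (word_value \<phi> (Q_op V v))"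
proof -
  note Cons = word_endo_Cons[where \<phi> = \<phi>, OF functional_zero[OF \<phi>]]
  have snoc: "word_value \<phi> v (w @ [endo_series (Q_op V)]) = word_value \<phi> (Q_op V v) w"
      "word_defined \<phi> v (w @ [endo_series (Q_op V)]) = word_defined \<phi> (Q_op V v) w"
    if "\<forall>g\<in>set w. \<forall>k. lin (g k)" for w
    using that by (intro word_endo_snoc functional_zero[OF \<phi>] ballI allI lin_zero; blast)+
  note cong = n_op_cong[of "\<lambda>w. word_value \<phi> v (w @ [endo_series (Q_op V)])" "word_value \<phi> (Q_op V v)"
      "\<lambda>w. word_defined \<phi> v (w @ [endo_series (Q_op V)])" "word_defined \<phi> (Q_op V v)", OF snoc]
  show "matrix_element \<phi> (Q_bracket V q (n_op V \<rho> \<alpha>\<^sub>1 \<alpha>\<^sub>2 a A b B C t)) v =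
      matrix_element (\<phi> \<circ> Q_op V) (n_op V \<rho> \<alpha>\<^sub>1 \<alpha>\<^sub>2 a A b B C t) v -
      (-1) powi q * matrix_element \<phi> (n_op V \<rho> \<alpha>\<^sub>1 \<alpha>\<^sub>2 a A b B C t) (Q_op V v)"
    by (simp add: matrix_element_def Q_bracket_def supercomm_def Minus_def endo_eq_Factor Cons cong)
  show "expr_defined (Q_bracket V q (n_op V \<rho> \<alpha>\<^sub>1 \<alpha>\<^sub>2 a A b B C t)) (word_defined \<phi> v) (word_value \<phi> v) \<longleftrightarrow>
      expr_defined (n_op V \<rho> \<alpha>\<^sub>1 \<alpha>\<^sub>2 a A b B C t) (word_defined (\<phi> \<circ> Q_op V) v) (word_value (\<phi> \<circ> Q_op V) v) \<and>
      expr_defined (n_op V \<rho> \<alpha>\<^sub>1 \<alpha>\<^sub>2 a A b B C t) (word_defined \<phi> (Q_op V v)) (word_value \<phi> (Q_op V v))"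
    by (simp add: Q_bracket_def supercomm_def Minus_def endo_eq_Factor Cons cong)
qed

text \<open>
  In both integrands the operator \<open>b_{-1}\<close> also occurs to the right of \<open>B\<close>. The corresponding
  value \<open>W\<close> cancels between the two terms of the bracket.
\<close>

lemma n_op_matrix_element:
  fixes v :: 'v
  assumes \<phi>: "\<phi> \<in> restricted_dual V"
    and A: "A \<in> fermionic_space V a" and B: "B \<in> fermionic_space V b" and C: "C \<in> fermionic_space V c"
    and t: "t > 0" and \<alpha>: "0 < \<alpha>\<^sub>1" "0 < \<alpha>\<^sub>2" "\<alpha>\<^sub>1 + \<alpha>\<^sub>2 < \<rho>"
  shows "expr_defined (n_op V \<rho> \<alpha>\<^sub>1 \<alpha>\<^sub>2 a A b B C t) (word_defined \<phi> v) (word_value \<phi> v)"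
    and "matrix_element \<phi> (n_op V \<rho> \<alpha>\<^sub>1 \<alpha>\<^sub>2 a A b B C t) v =
      integral {\<alpha>\<^sub>2..\<rho> - \<alpha>\<^sub>1} (n'_density t \<rho> \<phi> v a A B C) + integral {- \<alpha>\<^sub>1..0} (m_density t \<rho> \<alpha>\<^sub>1 \<phi> v a A B C)"
    and "n'_density t \<rho> \<phi> v a A B C integrable_on {\<alpha>\<^sub>2..\<rho> - \<alpha>\<^sub>1}" and "m_density t \<rho> \<alpha>\<^sub>1 \<phi> v a A B C integrable_on {- \<alpha>\<^sub>1..0}"
proof -
  define W where "W t1 t2 = three_point V \<phi> v t1 A t2 B t (\<beta> C) +
      (-1) powi c * three_point V \<phi> (\<beta> v) t1 A t2 B t C" for t1 t2
  have words: "word_has_sum \<phi> v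
      [vertex_series V A t1, vertex_series V B t2, endo_series \<beta>, vertex_series V C t]
      (W t1 t2)"
    "word_has_sum \<phi> v
      [vertex_series V A t1, endo_series \<beta>, vertex_series V B t2, vertex_series V C t]
      (three_point V \<phi> v t1 A t2 (\<beta> B) t C + (-1) powi b * W t1 t2)"
    "word_has_sum \<phi> v
      [endo_series \<beta>, vertex_series V A t1, vertex_series V B t2, vertex_series V C t]
      (three_point V \<phi> v t1 (\<beta> A) t2 B t C +
        (-1) powi a * (three_point V \<phi> v t1 A t2 (\<beta> B) t C + (-1) powi b * W t1 t2))"
    if "t1 > t2" "t2 > t" for t1 t2
    using zero_mode_words[OF \<phi> that t b_grade A B C, of v]
    by (simp_all add: W_def \<beta>_eq power_int_minus_one_minus)
  have I_eq: "(-1) powi a *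
      (word_value \<phi> v [vertex_series V A (t + \<rho>), endo_series \<beta>, vertex_series V B (s + t), vertex_series V C t]
       - (-1) powi (-b) *
         word_value \<phi> v [vertex_series V A (t + \<rho>), vertex_series V B (s + t), endo_series \<beta>, vertex_series V C t]) = n'_density t \<rho> \<phi> v a A B C s"
    if "s \<in> {\<alpha>\<^sub>2..\<rho> - \<alpha>\<^sub>1}" for s
    using words[of "s + t" "t + \<rho>"] that \<alpha>
    by (simp add: word_has_sum_iff n'_density_def power_int_minus_one_minus add.commute)
  have K_eq: "word_value \<phi> v [endo_series \<beta>, vertex_series V A (s + (t + \<rho>) + \<alpha>\<^sub>1), vertex_series V B (s + (t + \<rho>)), vertex_series V C t]
       - (-1) powi (-(a + b)) *
         word_value \<phi> v [vertex_series V A (s + (t + \<rho>) + \<alpha>\<^sub>1), vertex_series V B (s + (t + \<rho>)), endo_series \<beta>, vertex_series V C t] = m_density t \<rho> \<alpha>\<^sub>1 \<phi> v a A B C s"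
    if "s \<in> {- \<alpha>\<^sub>1..0}" for s
    using words[of "s + (t + \<rho>)" "s + (t + \<rho>) + \<alpha>\<^sub>1"] that \<alpha>
    by (simp add: word_has_sum_iff m_density_def power_int_minus_one_minus[of "a + b"] power_int_add algebra_simps del: minus_add_distrib)
  have I_cont: "continuous_on {\<alpha>\<^sub>2..\<rho> - \<alpha>\<^sub>1} (n'_density t \<rho> \<phi> v a A B C)"
    using three_point_continuous[OF \<phi>, where S = "{\<alpha>\<^sub>2..\<rho> - \<alpha>\<^sub>1}" and p = "t + \<rho>" and x = 0 and q = t and y = 1 and r = t] t \<alpha>
    unfolding n'_density_def by (intro continuous_intros) auto
  have K_cont: "continuous_on {- \<alpha>\<^sub>1..0} (m_density t \<rho> \<alpha>\<^sub>1 \<phi> v a A B C)"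
    using three_point_continuous[OF \<phi>, where S = "{- \<alpha>\<^sub>1..0}" and p = "t + \<rho> + \<alpha>\<^sub>1" and x = 1 and q = "t + \<rho>" and y = 1 and r = t] t \<alpha>
    unfolding m_density_def by (intro continuous_intros) auto
  show "n'_density t \<rho> \<phi> v a A B C integrable_on {\<alpha>\<^sub>2..\<rho> - \<alpha>\<^sub>1}" "m_density t \<rho> \<alpha>\<^sub>1 \<phi> v a A B C integrable_on {- \<alpha>\<^sub>1..0}"
    using I_cont K_cont by (auto intro: integrable_continuous_real)
  show "matrix_element \<phi> (n_op V \<rho> \<alpha>\<^sub>1 \<alpha>\<^sub>2 a A b B C t) v =
      integral {\<alpha>\<^sub>2..\<rho> - \<alpha>\<^sub>1} (n'_density t \<rho> \<phi> v a A B C) + integral {- \<alpha>\<^sub>1..0} (m_density t \<rho> \<alpha>\<^sub>1 \<phi> v a A B C)"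
    unfolding matrix_element_def n_op_expr_value
    by (intro arg_cong2[where f = "(+)"] Henstock_Kurzweil_Integration.integral_cong I_eq K_eq)
  show "expr_defined (n_op V \<rho> \<alpha>\<^sub>1 \<alpha>\<^sub>2 a A b B C t) (word_defined \<phi> v) (word_value \<phi> v)"
    unfolding n_op_expr_defined
  proof (intro conjI ballI)
    show "\<alpha>\<^sub>2 \<le> \<rho> - \<alpha>\<^sub>1" "- \<alpha>\<^sub>1 \<le> 0"
      using \<alpha> by auto
    show "word_defined \<phi> v [vertex_series V A (t + \<rho>), endo_series \<beta>, vertex_series V B (s + t), vertex_series V C t]"
      "word_defined \<phi> v [vertex_series V A (t + \<rho>), vertex_series V B (s + t), endo_series \<beta>, vertex_series V C t]"
      if "s \<in> {\<alpha>\<^sub>2..\<rho> - \<alpha>\<^sub>1}" for s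
      using words[of "s + t" "t + \<rho>"] that \<alpha> by (auto simp: word_has_sum_iff)
    show "word_defined \<phi> v [endo_series \<beta>, vertex_series V A (s + (t + \<rho>) + \<alpha>\<^sub>1), vertex_series V B (s + (t + \<rho>)), vertex_series V C t]"
      "word_defined \<phi> v [vertex_series V A (s + (t + \<rho>) + \<alpha>\<^sub>1), vertex_series V B (s + (t + \<rho>)), endo_series \<beta>, vertex_series V C t]"
      if "s \<in> {- \<alpha>\<^sub>1..0}" for s
      using words[of "s + (t + \<rho>)" "s + (t + \<rho>) + \<alpha>\<^sub>1"] that \<alpha> by (auto simp: word_has_sum_iff)
  qed (rule absolutely_integrable_continuous_real,
       rule continuous_on_eq[OF I_cont I_eq[symmetric]] continuous_on_eq[OF K_cont K_eq[symmetric]], assumption)+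
qed

text \<open>
  Moving \<open>Q\<close> from \<open>\<phi>\<close> through \<open>A\<close>, \<open>b_{-1} B\<close> and \<open>C\<close> produces the other four terms on
  the left up to sign, except that \<open>Q b_{-1} B\<close> takes the place of \<open>b_{-1} Q B\<close>. These two
  add up to \<open>L_{-1} B\<close>. The signs match because \<open>b_{-1} B\<close> has parity opposite to \<open>B\<close>.
\<close>

lemma n'_density_homotopy:
  assumes \<phi>: "\<phi> \<in> restricted_dual V" and t: "t > 0" "s > 0" "s < \<rho>"
    and A: "A \<in> fermionic_space V a" and B: "B \<in> fermionic_space V b" and C: "C \<in> fermionic_space V c"
  shows "n'_density t \<rho> (\<phi> \<circ> Q_op V) v a A B C s
      - (-1) powi (a + b + c - 1) * n'_density t \<rho> \<phi> (Q_op V v) a A B C s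
      + n'_density t \<rho> \<phi> v (a + 1) (Q_op V A) B C s
      + (-1) powi a * n'_density t \<rho> \<phi> v a A (Q_op V B) C s
      + (-1) powi (a + b) * n'_density t \<rho> \<phi> v a A B (Q_op V C) s
    = three_point V \<phi> v (t + \<rho>) A (t + s) (L_deriv B) t C"
proof -
  have ord: "t + \<rho> > t + s" "t + s > t" using t by auto
  have \<beta>B: "\<beta> B \<in> fermionic_space V (b + -1)"
    using mode_fermionic_space[OF b_grade B, of 0] by (simp add: \<beta>_eq)
  note W = three_point_Ward[OF \<phi> ord t(1) J_grade A \<beta>B C, of v, folded Q_eq]
  note L = three_point_add(2)[OF \<phi> ord t(1), of v A "Q_op V (\<beta> B)" "\<beta> (Q_op V B)" C, unfolded Q_b]
  show ?thesis
    unfolding n'_density_def W L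
    using sign_cases[of a] sign_cases[of b] sign_cases[of c]
    by (elim disjE) (simp_all add: power_int_add power_int_diff)
qed

text \<open>
  The same cancellation for each of the two summands of the density.
\<close>

lemma m_density_homotopy:
  assumes \<phi>: "\<phi> \<in> restricted_dual V" and t: "t > 0" "\<alpha> > 0" "\<rho> + s > 0"
    and A: "A \<in> fermionic_space V a" and B: "B \<in> fermionic_space V b" and C: "C \<in> fermionic_space V c"
  shows "m_density t \<rho> \<alpha> (\<phi> \<circ> Q_op V) v a A B C s
      - (-1) powi (a + b + c - 1) * m_density t \<rho> \<alpha> \<phi> (Q_op V v) a A B C s
      + m_density t \<rho> \<alpha> \<phi> v (a + 1) (Q_op V A) B C s
      + (-1) powi a * m_density t \<rho> \<alpha> \<phi> v a A (Q_op V B) C s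
      + (-1) powi (a + b) * m_density t \<rho> \<alpha> \<phi> v a A B (Q_op V C) s
    = three_point V \<phi> v (t + \<rho> + \<alpha> + s) (L_deriv A) (t + \<rho> + s) B t C +
      three_point V \<phi> v (t + \<rho> + \<alpha> + s) A (t + \<rho> + s) (L_deriv B) t C"
proof -
  have ord: "t + \<rho> + \<alpha> + s > t + \<rho> + s" "t + \<rho> + s > t" using t by auto
  have \<beta>A: "\<beta> A \<in> fermionic_space V (a + -1)"
    using mode_fermionic_space[OF b_grade A, of 0] by (simp add: \<beta>_eq)
  have \<beta>B: "\<beta> B \<in> fermionic_space V (b + -1)"
    using mode_fermionic_space[OF b_grade B, of 0] by (simp add: \<beta>_eq)
  note W1 = three_point_Ward[OF \<phi> ord t(1) J_grade \<beta>A B C, of v, folded Q_eq]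
  note W2 = three_point_Ward[OF \<phi> ord t(1) J_grade A \<beta>B C, of v, folded Q_eq]
  note L1 = three_point_add(1)[OF \<phi> ord t(1), of v "Q_op V (\<beta> A)" "\<beta> (Q_op V A)" B C, unfolded Q_b]
  note L2 = three_point_add(2)[OF \<phi> ord t(1), of v A "Q_op V (\<beta> B)" "\<beta> (Q_op V B)" C, unfolded Q_b]
  show ?thesis
    unfolding m_density_def W1 W2 L1 L2
    using sign_cases[of a] sign_cases[of b] sign_cases[of c]
    by (elim disjE) (simp_all add: power_int_add power_int_diff)
qed

lemma three_point_FTC:
  assumes \<phi>: "\<phi> \<in> restricted_dual V" and "l \<le> r" and "\<And>s. s \<in> {l..r} \<Longrightarrow> p + x * s > q + y * s"
    "\<And>s. s \<in> {l..r} \<Longrightarrow> q + y * s > t" "t > 0"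
  shows "((\<lambda>s. of_real x * three_point V \<phi> v (p + x * s) (L_deriv A) (q + y * s) B t C +
      of_real y * three_point V \<phi> v (p + x * s) A (q + y * s) (L_deriv B) t C)
    has_integral (three_point V \<phi> v (p + x * r) A (q + y * r) B t C -
      three_point V \<phi> v (p + x * l) A (q + y * l) B t C)) {l..r}"
  using assms
  by (auto intro!: fundamental_theorem_of_calculus
      has_vector_derivative_at_within[OF three_point_has_vector_derivative[OF \<phi>]])

end

theorem proposition3p2:
  fixes V :: "('v::ab_group_add) tvoa"
    and A B C :: 'v
    and a b c :: int
    and t \<rho> \<alpha>\<^sub>1 \<alpha>\<^sub>2 :: real
  assumes "topological_vertex_operator_algebra V"
    and "A \<in> fermionic_space V a"
    and "B \<in> fermionic_space V b"
    and "C \<in> fermionic_space V c"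
    and "t > 0"
    and "0 < \<alpha>\<^sub>1" and "0 < \<alpha>\<^sub>2" and "\<alpha>\<^sub>1 + \<alpha>\<^sub>2 < \<rho>"
  shows "weakly_equal V
    (pairing \<rho> (pairing \<alpha>\<^sub>1 (vertex_op V A) (vertex_op V B)) (vertex_op V C) t
      \<ominus> pairing \<rho> (vertex_op V A) (pairing \<alpha>\<^sub>2 (vertex_op V B) (vertex_op V C)) t)
    (Q_bracket V (a + b + c - 1) (n_op V \<rho> \<alpha>\<^sub>1 \<alpha>\<^sub>2 a A b B C t)
      \<oplus> n_op V \<rho> \<alpha>\<^sub>1 \<alpha>\<^sub>2 (a + 1) (Q_op V A) b B C t
      \<oplus> (-1) powi a \<cdot>\<^sub>e n_op V \<rho> \<alpha>\<^sub>1 \<alpha>\<^sub>2 a A (b + 1) (Q_op V B) C t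
      \<oplus> (-1) powi (a + b) \<cdot>\<^sub>e n_op V \<rho> \<alpha>\<^sub>1 \<alpha>\<^sub>2 a A b B (Q_op V C) t)"
  (is "weakly_equal V ?lhs ?rhs")
proof -
  interpret topological_vertex_operator_algebra V by fact
  note A = assms(2) and B = assms(3) and C = assms(4) and t = assms(5) and \<alpha> = assms(6-8)
  have QA: "Q_op V A \<in> fermionic_space V (a + 1)" and QB: "Q_op V B \<in> fermionic_space V (b + 1)"
    and QC: "Q_op V C \<in> fermionic_space V (c + 1)"
    using mode_fermionic_space[OF J_grade] A B C unfolding Q_eq by blast+
  have "expr_defined ?lhs (word_defined \<phi> v) (word_value \<phi> v)"
    and "expr_defined ?rhs (word_defined \<phi> v) (word_value \<phi> v)"
    and "matrix_element \<phi> ?lhs v = matrix_element \<phi> ?rhs v"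
    if \<phi>: "\<phi> \<in> restricted_dual V" for \<phi> v
  proof -
    have lin: "functional \<phi>"
      using \<phi> by (auto simp: restricted_dual_def)
    have \<phi>Q: "\<phi> \<circ> Q_op V \<in> restricted_dual V"
      using restricted_dual_comp_mode[OF \<phi> J_grade] by (simp add: Q_eq)
    note n1 = n_op_matrix_element[OF \<phi>Q A B C t \<alpha>, of v]
      and n2 = n_op_matrix_element[OF \<phi> A B C t \<alpha>, of "Q_op V v"]
      and n3 = n_op_matrix_element[OF \<phi> QA B C t \<alpha>, of v]
      and n4 = n_op_matrix_element[OF \<phi> A QB C t \<alpha>, of v]
      and n5 = n_op_matrix_element[OF \<phi> A B QC t \<alpha>, of v]
    have words: "word_has_sum \<phi> v [vertex_series V A (t + \<rho> + \<alpha>\<^sub>1), vertex_series V B (t + \<rho>), vertex_series V C t]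
        (three_point V \<phi> v (t + \<rho> + \<alpha>\<^sub>1) A (t + \<rho>) B t C)"
      "word_has_sum \<phi> v [vertex_series V A (t + \<rho>), vertex_series V B (t + \<alpha>\<^sub>2), vertex_series V C t]
        (three_point V \<phi> v (t + \<rho>) A (t + \<alpha>\<^sub>2) B t C)"
      using t \<alpha> by (auto intro!: word_has_sum_three_point \<phi>)
    show "expr_defined ?lhs (word_defined \<phi> v) (word_value \<phi> v)"
      using words by (simp add: pairing_def Minus_def vertex_op_eq_Factor word_has_sum_iff)
    show "expr_defined ?rhs (word_defined \<phi> v) (word_value \<phi> v)"
      using n1(1) n2(1) n3(1) n4(1) n5(1) by (simp add: Q_bracket_n_op[OF lin])
    have lhs: "matrix_element \<phi> ?lhs v =
        three_point V \<phi> v (t + \<rho> + \<alpha>\<^sub>1) A (t + \<rho>) B t C - three_point V \<phi> v (t + \<rho>) A (t + \<alpha>\<^sub>2) B t C"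
      using words by (simp add: matrix_element_def pairing_def Minus_def vertex_op_eq_Factor word_has_sum_iff)
    let ?I = "{\<alpha>\<^sub>2..\<rho> - \<alpha>\<^sub>1}" and ?J = "{- \<alpha>\<^sub>1..0}"
    have "matrix_element \<phi> ?rhs v =
        (integral ?I (n'_density t \<rho> (\<phi> \<circ> Q_op V) v a A B C)
        - (-1) powi (a + b + c - 1) * integral ?I (n'_density t \<rho> \<phi> (Q_op V v) a A B C)
        + integral ?I (n'_density t \<rho> \<phi> v (a + 1) (Q_op V A) B C)
        + (-1) powi a * integral ?I (n'_density t \<rho> \<phi> v a A (Q_op V B) C)
        + (-1) powi (a + b) * integral ?I (n'_density t \<rho> \<phi> v a A B (Q_op V C))) +
        (integral ?J (m_density t \<rho> \<alpha>\<^sub>1 (\<phi> \<circ> Q_op V) v a A B C)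
        - (-1) powi (a + b + c - 1) * integral ?J (m_density t \<rho> \<alpha>\<^sub>1 \<phi> (Q_op V v) a A B C)
        + integral ?J (m_density t \<rho> \<alpha>\<^sub>1 \<phi> v (a + 1) (Q_op V A) B C)
        + (-1) powi a * integral ?J (m_density t \<rho> \<alpha>\<^sub>1 \<phi> v a A (Q_op V B) C)
        + (-1) powi (a + b) * integral ?J (m_density t \<rho> \<alpha>\<^sub>1 \<phi> v a A B (Q_op V C)))" (is "_ = ?N' + ?M")
      using n1(2) n2(2) n3(2) n4(2) n5(2) Q_bracket_n_op(1)[OF lin, of "a + b + c - 1" \<rho> \<alpha>\<^sub>1 \<alpha>\<^sub>2 a A b B C t v]
      by (simp add: matrix_element_def algebra_simps)
    \<comment> \<open>The two integrals share the boundary point with \<open>B\<close> at \<open>t + (\<rho> - \<alpha>\<^sub>1)\<close>, which cancels.\<close>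
    also have "?N' = three_point V \<phi> v (t + \<rho>) A (t + (\<rho> - \<alpha>\<^sub>1)) B t C - three_point V \<phi> v (t + \<rho>) A (t + \<alpha>\<^sub>2) B t C"
    proof -
      have "((\<lambda>s. n'_density t \<rho> (\<phi> \<circ> Q_op V) v a A B C s
          - (-1) powi (a + b + c - 1) * n'_density t \<rho> \<phi> (Q_op V v) a A B C s
          + n'_density t \<rho> \<phi> v (a + 1) (Q_op V A) B C s
          + (-1) powi a * n'_density t \<rho> \<phi> v a A (Q_op V B) C s
          + (-1) powi (a + b) * n'_density t \<rho> \<phi> v a A B (Q_op V C) s) has_integral ?N') ?I"
        by (intro has_integral_add has_integral_diff has_integral_mult_right integrable_integral
            n1(3) n2(3) n3(3) n4(3) n5(3))
      then have "((\<lambda>s. three_point V \<phi> v (t + \<rho>) A (t + s) (L_deriv B) t C) has_integral ?N') ?I"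
        by (rule has_integral_eq[rotated]) (use t \<alpha> in \<open>auto intro!: n'_density_homotopy \<phi> A B C\<close>)
      moreover have "((\<lambda>s. three_point V \<phi> v (t + \<rho>) A (t + s) (L_deriv B) t C) has_integral
          (three_point V \<phi> v (t + \<rho>) A (t + (\<rho> - \<alpha>\<^sub>1)) B t C - three_point V \<phi> v (t + \<rho>) A (t + \<alpha>\<^sub>2) B t C)) ?I"
        using three_point_FTC[OF \<phi>, of \<alpha>\<^sub>2 "\<rho> - \<alpha>\<^sub>1" t 1 "t + \<rho>" 0 t v A B C] t \<alpha> by simp
      ultimately show ?thesis
        by (rule has_integral_unique)
    qed
    also have "?M = three_point V \<phi> v (t + \<rho> + \<alpha>\<^sub>1) A (t + \<rho>) B t C - three_point V \<phi> v (t + \<rho>) A (t + (\<rho> - \<alpha>\<^sub>1)) B t C"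
    proof -
      have "((\<lambda>s. m_density t \<rho> \<alpha>\<^sub>1 (\<phi> \<circ> Q_op V) v a A B C s
          - (-1) powi (a + b + c - 1) * m_density t \<rho> \<alpha>\<^sub>1 \<phi> (Q_op V v) a A B C s
          + m_density t \<rho> \<alpha>\<^sub>1 \<phi> v (a + 1) (Q_op V A) B C s
          + (-1) powi a * m_density t \<rho> \<alpha>\<^sub>1 \<phi> v a A (Q_op V B) C s
          + (-1) powi (a + b) * m_density t \<rho> \<alpha>\<^sub>1 \<phi> v a A B (Q_op V C) s) has_integral ?M) ?J"
        by (intro has_integral_add has_integral_diff has_integral_mult_right integrable_integral
            n1(4) n2(4) n3(4) n4(4) n5(4))
      then have "((\<lambda>s. three_point V \<phi> v (t + \<rho> + \<alpha>\<^sub>1 + s) (L_deriv A) (t + \<rho> + s) B t C +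
          three_point V \<phi> v (t + \<rho> + \<alpha>\<^sub>1 + s) A (t + \<rho> + s) (L_deriv B) t C) has_integral ?M) ?J"
        by (rule has_integral_eq[rotated]) (use t \<alpha> in \<open>auto intro!: m_density_homotopy \<phi> A B C\<close>)
      moreover have "((\<lambda>s. three_point V \<phi> v (t + \<rho> + \<alpha>\<^sub>1 + s) (L_deriv A) (t + \<rho> + s) B t C +
          three_point V \<phi> v (t + \<rho> + \<alpha>\<^sub>1 + s) A (t + \<rho> + s) (L_deriv B) t C) has_integral
          (three_point V \<phi> v (t + \<rho> + \<alpha>\<^sub>1) A (t + \<rho>) B t C - three_point V \<phi> v (t + \<rho>) A (t + (\<rho> - \<alpha>\<^sub>1)) B t C)) ?J"
        using three_point_FTC[OF \<phi>, of "- \<alpha>\<^sub>1" 0 "t + \<rho>" 1 "t + \<rho> + \<alpha>\<^sub>1" 1 t v A B C] t \<alpha>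
        by (simp add: add_diff_eq)
      ultimately show ?thesis
        by (rule has_integral_unique)
    qed
    finally show "matrix_element \<phi> ?lhs v = matrix_element \<phi> ?rhs v"
      using lhs by simp
  qed
  then show ?thesis
    unfolding weakly_equal_def weakly_defined_def by blast
qed

end
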